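(* Consider the interconnection of $n$ impulsive subsystems $$\dot x_i(t)=f_i(x_1(t),\dots,x_n(t),u_i(t)),\ t\ne t_k,\qquad x_i(t)=g_i(x_1^-(t),\dots,x_n^-(t),u_i^-(t)),\ t=t_k,$$ $k\in\mathbb{N}$, $i=1,\dots,n$, viewed as the single system $\dot x=f(x,u)$, $t\neq t_k$, $x(t)=g(x^-(t),u^-(t))$, $t=t_k$, with $x=(x_1^T,\dots,x_n^T)^T$, $u=(u_1^T,\dots,u_n^T)^T$, $f=(f_1^T,\dots,f_n^T)^T$, $g=(g_1^T,\dots,g_n^T)^T$. Assume each subsystem has an exponential ISS-Lyapunov function $V_i$ with linear gains $\gamma_{ij}(r)=\gamma_{ij}r$ ($\gamma_{ij}\ge0$, $\gamma_{ii}=0$), gains $\gamma_i$, and rate coefficients $c_i,d_i$ with $d_i\ne0$. If the matrix $\Gamma=(\gamma_{ij})_{n\times n}$ satisfies the small-gain condition $\Gamma(v)\not\ge v$ for all $v\in\mathbb{R}^n_+\setminus\{0\}$, then for any $s=(s_1,\dots,s_n)^T\in\mathbb{R}^n$ with $s>0$ and $\Gamma(s)<s$, the function $$V(x):=\max_i\Big\{\tfrac{1}{s_i}V_i(x_i)\Big\}$$ is an exponential ISS-Lyapunov function for the whole system with gain $\gamma(r):=\max\{e^d,1\}\max_i\frac{1}{s_i}\gamma_i(r)$ and rate coefficients $c:=\min_i c_i$ and $d:=\min_{i,j,\,j\ne i}\{d_i,-\ln(\tfrac{s_j}{s_i}\gamma_{ij})\}$. In particular, for all $\mu,\lambda>0$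 the system is uniformly ISS over $\mathcal{S}[\mu,\lambda]$, the class of impulse time sequences satisfying $-dN(t,s')-(c-\lambda)(t-s')\le\mu$ for all $t\ge s'\ge t_0$.
   Context: $x_i\in\mathbb{R}^{N_i}$ is absolutely continuous between impulses, $u_i\in\mathbb{R}^{M_i}$ are locally bounded, Lebesgue measurable inputs; all signals are right-continuous with left limits, $x_i^-(t)=\lim_{s\nearrow t}x_i(s)$, $u_i^-(t)=\lim_{s\nearrow t}u_i(s)$. Each $f_i$ is locally Lipschitz. The impulse times (common to all subsystems) form a strictly increasing sequence in $(t_0,\infty)$, finite or infinite and unbounded, with no finite accumulation point; $N(t,s)$ is the number of impulse times in $(s,t]$. $\mathbb{R}_+=[0,\infty)$; for vectors, $x\ge y$ means $x_i\ge y_i$ for all $i$, $x\not\ge y$ means $x_i<y_i$ for some $i$, and $x>y$ means $x_i>y_i$ for all $i$. The gain operator is $\Gamma(v):=(\max_j\gamma_{1j}v_j,\dots,\max_j\gamma_{nj}v_j)^T$ for $v\in\mathbb{R}^n_+$. $\mathcal{K}_\infty$ is the class of continuous, strictly increasing, unbounded $\gamma:\mathbb{R}_+\to\mathbb{R}_+$ with $\gamma(0)=0$; $\mathcal{KL}$ is the class of $\beta$ with $\beta(\cdot,t)$ continuous strictly increasing with $\beta(0,t)=0$ and $\beta(r,\cdot)$ continuous decreasing to $0$. Subsystem Lyapunov functions: $V_i:\mathbb{R}^{N_i}\to\mathbb{R}_+$ is continuous, proper, positive definite and locally Lipschitz on $\mathbb{R}^{N_i}\setminus\{0\}$; it is an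 exponential ISS-Lyapunov function with rate coefficients $c_i,d_i\in\mathbb{R}$ if there are $\gamma_{ij},\gamma_i\in\mathcal{K}_\infty$ (here $\gamma_{ij}$ linear) such that whenever $V_i(x_i)\ge\max\{\max_{j\ne i}\gamma_{ij}(V_j(x_j)),\gamma_i(|u_i|)\}$ then $\nabla V_i(x_i)\cdot f_i(x,u_i)\le-c_iV_i(x_i)$ for almost all $x$ and all $u_i$, and for all $x,u_i$: $V_i(g_i(x,u_i))\le\max\{e^{-d_i}V_i(x_i),\max_{j\ne i}\gamma_{ij}(V_j(x_j)),\gamma_i(|u_i|)\}$. Whole-system exponential ISS-Lyapunov function with rate coefficients $c,d$ and gain $\gamma\in\mathcal{K}_\infty$: $V:\mathbb{R}^N\to\mathbb{R}_+$ locally Lipschitz, positive definite, radially unbounded, such that whenever $V(x)\ge\gamma(|u|)$: $\nabla V(x)\cdot f(x,u)\le-cV(x)$ for almost all $x$ and all $u$, and $V(g(x,u))\le e^{-d}V(x)$ for all $x,u$. Uniformly ISS over a class $\mathcal{S}$: there exist $\beta\in\mathcal{KL}$, $\tilde\gamma\in\mathcal{K}_\infty$ independent of the sequence in $\mathcal{S}$ such that for every sequence in $\mathcal{S}$, every initial condition and input, the solution exists globally and $|x(t)|\le\max\{\beta(|x(t_0)|,t-t_0),\tilde\gamma(\|u\|_{[t_0,t]})\}$ for all $t\ge t_0$.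
   Formalization: V is shown to be continuous on R^N and locally Lipschitz on R^N\{0} only, not at 0: since the V_i are locally Lipschitz only away from 0 (e.g. V_1(x)=√|x|, f=-x, g=x/2), V need not be Lipschitz at the origin. *)

theory Defs
  imports "HOL-Analysis.Analysis"
begin

definition Kinf :: "(real \<Rightarrow> real) \<Rightarrow> bool" where
  "Kinf \<gamma> \<longleftrightarrow> continuous_on {0..} \<gamma> \<and> strict_mono_on {0..} \<gamma> \<and> \<gamma> 0 = 0
     \<and> filterlim \<gamma> at_top at_top"

definition KL :: "(real \<Rightarrow> real \<Rightarrow> real) \<Rightarrow> bool" where
  "KL \<beta> \<longleftrightarrow>
     (\<forall>t\<ge>0. continuous_on {0..} (\<lambda>r. \<beta> r t) \<and> strict_mono_on {0..} (\<lambda>r. \<beta> r t) \<and> \<beta> 0 t = 0) \<and>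
     (\<forall>r\<ge>0. continuous_on {0..} (\<beta> r) \<and> (\<forall>a b. 0 \<le> a \<longrightarrow> a \<le> b \<longrightarrow> \<beta> r b \<le> \<beta> r a)
            \<and> (\<beta> r \<longlongrightarrow> 0) at_top)"

text \<open>The whole state lives in a Euclidean space; its orthonormal basis is partitioned
  into blocks B 0, ..., B (n-1); subsystem i's state space R^{N_i} is span (B i) and
  x_i is the orthogonal projection of x onto it.  Same for inputs with blocks C i.\<close>

definition bproj :: "'a::euclidean_space set \<Rightarrow> 'a \<Rightarrow> 'a" where
  "bproj B x = (\<Sum>b\<in>B. (x \<bullet> b) *\<^sub>R b)"

definition basis_partition :: "nat \<Rightarrow> (nat \<Rightarrow> 'a::euclidean_space set) \<Rightarrow> bool" where
  "basis_partition n B \<longleftrightarrow> (\<Union>i<n. B i) = Basis \<and>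
     (\<forall>i<n. \<forall>j<n. i \<noteq> j \<longrightarrow> B i \<inter> B j = {})"

definition loc_lipschitz_on :: "'a::metric_space set \<Rightarrow> ('a \<Rightarrow> 'b::metric_space) \<Rightarrow> bool" where
  "loc_lipschitz_on S h \<longleftrightarrow> (\<forall>z\<in>S. \<exists>e>0. \<exists>L. \<forall>p\<in>ball z e \<inter> S. \<forall>q\<in>ball z e \<inter> S.
      dist (h p) (h q) \<le> L * dist p q)"

definition sub_lyap_candidate :: "'x::euclidean_space set \<Rightarrow> ('x \<Rightarrow> real) \<Rightarrow> bool" where
  "sub_lyap_candidate B W \<longleftrightarrow>
     continuous_on (span B) W \<and>
     (\<forall>K. compact K \<longrightarrow> compact {\<xi>\<in>span B. W \<xi> \<in> K}) \<and>
     W 0 = 0 \<and> (\<forall>\<xi>\<in>span B. \<xi> \<noteq> 0 \<longrightarrow> W \<xi> > 0) \<and>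
     loc_lipschitz_on (span B - {0}) W"

text \<open>max over j<n, j \<noteq> i of gamma_ij V_j(x_j)  (0 if there is no such j; all terms are \<ge> 0)\<close>
definition others :: "nat \<Rightarrow> (nat \<Rightarrow> 'x::euclidean_space set) \<Rightarrow> (nat \<Rightarrow> 'x \<Rightarrow> real)
    \<Rightarrow> (nat \<Rightarrow> nat \<Rightarrow> real) \<Rightarrow> nat \<Rightarrow> 'x \<Rightarrow> real" where
  "others n B V G i x = Max ({0} \<union> (\<lambda>j. G i j * V j (bproj (B j) x)) ` ({..<n} - {i}))"

definition sub_exp_iss_lyap ::
  "nat \<Rightarrow> (nat \<Rightarrow> 'x::euclidean_space set) \<Rightarrow> (nat \<Rightarrow> 'u::euclidean_space set)
   \<Rightarrow> ('x \<Rightarrow> 'u \<Rightarrow> 'x) \<Rightarrow> ('x \<Rightarrow> 'u \<Rightarrow> 'x) \<Rightarrow> (nat \<Rightarrow> 'x \<Rightarrow> real)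
   \<Rightarrow> (nat \<Rightarrow> nat \<Rightarrow> real) \<Rightarrow> (nat \<Rightarrow> real \<Rightarrow> real) \<Rightarrow> (nat \<Rightarrow> real) \<Rightarrow> (nat \<Rightarrow> real)
   \<Rightarrow> nat \<Rightarrow> bool" where
  "sub_exp_iss_lyap n B C f g V G gam c d i \<longleftrightarrow>
     sub_lyap_candidate (B i) (V i) \<and> Kinf (gam i) \<and>
     (\<exists>Z\<in>null_sets lebesgue. \<forall>x. x \<notin> Z \<longrightarrow>
        (\<exists>D. (V i has_derivative D) (at (bproj (B i) x) within span (B i)) \<and>
             (\<forall>u. V i (bproj (B i) x) \<ge> max (others n B V G i x) (gam i (norm (bproj (C i) u)))
                  \<longrightarrow> D (bproj (B i) (f x u)) \<le> - c i * V i (bproj (B i) x)))) \<and>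
     (\<forall>x u. V i (bproj (B i) (g x u)) \<le>
        max (exp (- d i) * V i (bproj (B i) x)) (max (others n B V G i x) (gam i (norm (bproj (C i) u)))))"

definition exp_iss_lyap :: "('x::euclidean_space \<Rightarrow> 'u::euclidean_space \<Rightarrow> 'x) \<Rightarrow> ('x \<Rightarrow> 'u \<Rightarrow> 'x)
    \<Rightarrow> ('x \<Rightarrow> real) \<Rightarrow> real \<Rightarrow> real \<Rightarrow> (real \<Rightarrow> real) \<Rightarrow> bool" where
  "exp_iss_lyap f g W c d \<gamma> \<longleftrightarrow>
     continuous_on UNIV W \<and> loc_lipschitz_on (UNIV - {0}) W \<and>
     W 0 = 0 \<and> (\<forall>x. x \<noteq> 0 \<longrightarrow> W x > 0) \<and> filterlim W at_top at_infinity \<and> Kinf \<gamma> \<and>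
     (\<exists>Z\<in>null_sets lebesgue. \<forall>x. x \<notin> Z \<longrightarrow>
        (\<exists>D. (W has_derivative D) (at x) \<and>
             (\<forall>u. W x \<ge> \<gamma> (norm u) \<longrightarrow> D (f x u) \<le> - c * W x))) \<and>
     (\<forall>x u. W x \<ge> \<gamma> (norm u) \<longrightarrow> W (g x u) \<le> exp (- d) * W x)"

definition Gam :: "nat \<Rightarrow> (nat \<Rightarrow> nat \<Rightarrow> real) \<Rightarrow> (nat \<Rightarrow> real) \<Rightarrow> nat \<Rightarrow> real" where
  "Gam n G v i = Max ((\<lambda>j. G i j * v j) ` {..<n})"

definition Vtot :: "nat \<Rightarrow> (nat \<Rightarrow> 'x::euclidean_space set) \<Rightarrow> (nat \<Rightarrow> 'x \<Rightarrow> real)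
    \<Rightarrow> (nat \<Rightarrow> real) \<Rightarrow> 'x \<Rightarrow> real" where
  "Vtot n B V s x = Max ((\<lambda>i. V i (bproj (B i) x) / s i) ` {..<n})"

definition cmin :: "nat \<Rightarrow> (nat \<Rightarrow> real) \<Rightarrow> real" where
  "cmin n c = Min (c ` {..<n})"

text \<open>Terms with gamma_ij = 0 equal -ln 0 = +infinity and are therefore omitted from the min.\<close>
definition dmin :: "nat \<Rightarrow> (nat \<Rightarrow> nat \<Rightarrow> real) \<Rightarrow> (nat \<Rightarrow> real) \<Rightarrow> (nat \<Rightarrow> real) \<Rightarrow> real" where
  "dmin n G s d = Min (d ` {..<n} \<union>
      {- ln (s j / s i * G i j) | i j. i < n \<and> j < n \<and> j \<noteq> i \<and> G i j > 0})"

definition gain :: "nat \<Rightarrow> (nat \<Rightarrow> real \<Rightarrow> real) \<Rightarrow> (nat \<Rightarrow> real) \<Rightarrow> real \<Rightarrow> real \<Rightarrow> real" where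
  "gain n gam s dd r = max (exp dd) 1 * Max ((\<lambda>i. gam i r / s i) ` {..<n})"

text \<open>A set T of impulse times: strictly increasing sequence in (t0,inf), finite or
  unbounded, no finite accumulation point.\<close>
definition impulse_times :: "real \<Rightarrow> real set \<Rightarrow> bool" where
  "impulse_times t0 T \<longleftrightarrow> T \<subseteq> {t0<..} \<and> (\<forall>b. finite (T \<inter> {..b}))"

definition Ncount :: "real set \<Rightarrow> real \<Rightarrow> real \<Rightarrow> nat" where
  "Ncount T t s = card (T \<inter> {s<..t})"

definition seq_class :: "real \<Rightarrow> real \<Rightarrow> real \<Rightarrow> real \<Rightarrow> real \<Rightarrow> real set set" where
  "seq_class t0 c d \<mu> lam = {T. impulse_times t0 T \<and>
      (\<forall>s t. t0 \<le> s \<longrightarrow> s \<le> t \<longrightarrow> - d * real (Ncount T t s) - (c - lam) * (t - s) \<le> \<mu>)}"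

definition admissible_input :: "real \<Rightarrow> (real \<Rightarrow> 'u::euclidean_space) \<Rightarrow> bool" where
  "admissible_input t0 u \<longleftrightarrow> set_borel_measurable lebesgue {t0..} u \<and>
     (\<forall>b. bounded (u ` {t0..b})) \<and>
     (\<forall>t\<ge>t0. continuous (at_right t) u) \<and> (\<forall>t>t0. \<exists>l. (u \<longlongrightarrow> l) (at_left t))"

text \<open>x solves the impulsive system on [t0,inf): absolutely continuous (Caratheodory)
  between impulses and x(t) = g(x^-(t), u^-(t)) at impulse times.\<close>
definition is_solution :: "('x::euclidean_space \<Rightarrow> 'u::euclidean_space \<Rightarrow> 'x) \<Rightarrow> ('x \<Rightarrow> 'u \<Rightarrow> 'x)
    \<Rightarrow> real \<Rightarrow> real set \<Rightarrow> (real \<Rightarrow> 'u) \<Rightarrow> (real \<Rightarrow> 'x) \<Rightarrow> bool" where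
  "is_solution f g t0 T u x \<longleftrightarrow>
     (\<forall>a t. t0 \<le> a \<longrightarrow> a \<le> t \<longrightarrow> T \<inter> {a<..t} = {} \<longrightarrow>
        ((\<lambda>\<tau>. f (x \<tau>) (u \<tau>)) has_integral (x t - x a)) {a..t}) \<and>
     (\<forall>t\<in>T. \<exists>xl ul. (x \<longlongrightarrow> xl) (at_left t) \<and> (u \<longlongrightarrow> ul) (at_left t) \<and> x t = g xl ul)"

definition unif_ISS :: "('x::euclidean_space \<Rightarrow> 'u::euclidean_space \<Rightarrow> 'x) \<Rightarrow> ('x \<Rightarrow> 'u \<Rightarrow> 'x)
    \<Rightarrow> real \<Rightarrow> real set set \<Rightarrow> bool" where
  "unif_ISS f g t0 SS \<longleftrightarrow> (\<exists>\<beta> \<gamma>'. KL \<beta> \<and> Kinf \<gamma>' \<and>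
     (\<forall>T\<in>SS. \<forall>x0 u. admissible_input t0 u \<longrightarrow>
        (\<exists>x. is_solution f g t0 T u x \<and> x t0 = x0) \<and>
        (\<forall>x. is_solution f g t0 T u x \<longrightarrow> x t0 = x0 \<longrightarrow>
           (\<forall>t\<ge>t0. norm (x t) \<le> max (\<beta> (norm x0) (t - t0))
                                      (\<gamma>' (Sup ((\<lambda>\<tau>. norm (u \<tau>)) ` {t0..t})))))))"

end

theory Submission
  imports Defs
begin

text \<open>
  Each \<open>V\<^sub>i\<close> is differentiable almost everywhere, and so is their weighted maximum \<open>V\<close>: two
  differentiable functions that agree at a point with different derivatives have a difference with a
  regular zero there, and the regular zeros lie on countably many Lipschitz graphs over hyperplanes.
  At a point where \<open>V\<^sub>i / s\<^sub>i\<close> attains the maximum, \<open>\<Gamma>(s) < s\<close> makes \<open>V\<^sub>i\<close> dominate all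
  its internal gain terms, so the decay estimate of subsystem \<open>i\<close> applies.

  For the stability statement, the jump estimate is used in the form
  \<open>V(g(x,u)) \<le> max (exp(-d) V(x), \<gamma>(|u|))\<close> with \<open>\<gamma> = max\<^sub>i \<gamma>\<^sub>i / s\<^sub>i\<close>, which holds for all \<open>x\<close> and \<open>u\<close>.
  Inputs are right-continuous, so solutions have right derivatives everywhere. The gradient inequality
  holds only almost everywhere, but integrating \<open>V\<close> over a small box (dominated convergence) turns it
  into a bound on every increment \<open>V(x + h w) - V(x)\<close>, hence on the right Dini derivative of \<open>V\<close> along
  solutions. As long as \<open>V\<close> exceeds \<open>\<gamma>(\<parallel>u\<parallel>)\<close> it is therefore multiplied by at most
  \<open>exp(-c(t-s) - d N(t,s)) \<le> exp(\<mu> - \<lambda>(t-s))\<close> over \<open>(s,t]\<close>. The same estimate without jumps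
  excludes finite escape times, and so gives global existence.
\<close>

text \<open>The implication form of the jump condition says nothing about \<open>W (g x u)\<close>
  when \<open>W x\<close> is below the gain, so it puts no limit on how far an impulse driven by a
  large input can throw the state. Hence the max form with the smaller gain \<open>\<gamma>\<close>
  carries the stability argument, and the factor \<open>max (exp d) 1\<close> appears only when the
  implication is derived from it. The logarithms in \<open>d\<close> come from the same estimate: at
  an impulse \<open>V i\<close> can take the value \<open>G i j * V j\<close>, which in units of
  \<open>s i\<close> is at most \<open>G i j * s j / s i\<close> times \<open>W\<close>, so
  \<open>exp (- d)\<close> has to dominate these ratios along with each \<open>exp (- d i)\<close>.
  Neither \<open>c\<close> nor \<open>d\<close> has a fixed sign. \<open>W\<close> may grow along
  the flow or at the impulses, and only the combined factor over a whole interval is controlled; for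
  this reason the estimates remember the time at which \<open>W\<close> was last at or below the
  input level.\<close>

section \<open>Regular zeros, Dini derivatives and increments of Lipschitz functions\<close>

text \<open>The difference of two nearby zeros with a common approximate gradient \<open>w\<close>
  has at most half of its length along \<open>w\<close>. Projecting along \<open>w\<close> is
  therefore injective on them with a 2-Lipschitz inverse, and the image lies in a hyperplane.
  Countably many vectors \<open>w\<close> and scales are enough to catch every regular zero.\<close>

lemma negligible_regular_zeros:
  fixes F :: "'a::euclidean_space \<Rightarrow> real"
  shows "negligible {x. F x = 0 \<and> (\<exists>D. (F has_derivative D) (at x) \<and> D \<noteq> (\<lambda>_. 0))}"
proof -
  obtain Q :: "'a set" where Q: "countable Q" "\<And>X. open X \<Longrightarrow> X \<noteq> {} \<Longrightarrow> \<exists>q\<in>Q. q \<in> X"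
    using countable_dense_setE by metis
  \<comment> \<open>The set asks for linear approximation at one fixed scale by a vector from a
    countable set, instead of a derivative. If \<open>y\<close> is also a zero, the condition reads
    \<open>\<bar>w \<bullet> (y - x)\<bar> \<le> norm w / 2 * norm (y - x)\<close>.\<close>
  define A where "A w k = {x. F x = 0 \<and> (\<forall>y. norm (y - x) < 1 / Suc k \<longrightarrow>
      \<bar>F y - w \<bullet> (y - x)\<bar> \<le> norm w / 2 * norm (y - x))}" for w :: 'a and k :: nat
  have neg: "negligible (A w k)" if "w \<noteq> 0" for w k
    unfolding locally_negligible_alt[of "A w k"]
  proof
    fix x assume x: "x \<in> A w k"
    define U where "U = A w k \<inter> ball x (1 / (2 * Suc k))"
    define P where "P z = z - ((z \<bullet> w) / (w \<bullet> w)) *\<^sub>R w" for z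
    have lin: "P y - P z = (y - z) - (((y - z) \<bullet> w) / (w \<bullet> w)) *\<^sub>R w" for y z
      by (simp add: P_def algebra_simps diff_divide_distrib)
    have expand: "norm (y - z) \<le> 2 * norm (P y - P z)" if "y \<in> U" "z \<in> U" for y z
    proof -
      have "dist y z < 1 / Suc k"
        using that dist_triangle_half_r[of x y "1 / Suc k" z]
        by (auto simp: U_def field_simps)
      then have "\<bar>w \<bullet> (y - z)\<bar> \<le> norm w / 2 * norm (y - z)"
        using that by (auto simp: U_def A_def dist_norm norm_minus_commute)
      then have "norm ((((y - z) \<bullet> w) / (w \<bullet> w)) *\<^sub>R w) \<le> norm (y - z) / 2"
        using \<open>w \<noteq> 0\<close>
        by (simp add: field_simps inner_commute power2_norm_eq_inner[symmetric] power2_eq_square)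
      moreover have "norm (y - z) \<le> norm (P y - P z) + norm ((((y - z) \<bullet> w) / (w \<bullet> w)) *\<^sub>R w)"
        unfolding lin by (metis norm_triangle_sub add.commute)
      ultimately show ?thesis by linarith
    qed
    then have inj: "inj_on P U"
      by (fastforce intro!: inj_onI)
    have "negligible (P ` U)"
    proof (rule negligible_subset)
      show "negligible {z. w \<bullet> z = 0}" using \<open>w \<noteq> 0\<close> by (intro negligible_hyperplane) auto
      show "P ` U \<subseteq> {z. w \<bullet> z = 0}"
        using \<open>w \<noteq> 0\<close> by (auto simp: P_def inner_diff_right inner_commute)
    qed
    then have "negligible (inv_into U P ` (P ` U))"
    proof (rule negligible_locally_Lipschitz_image[rotated])
      fix z assume "z \<in> P ` U"
      then show "\<exists>T B. open T \<and> z \<in> T \<and> (\<forall>y \<in> P ` U \<inter> T.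
          norm (inv_into U P y - inv_into U P z) \<le> B * norm (y - z))"
        using expand by (intro exI[of _ UNIV] exI[of _ 2]) (auto simp: inv_into_f_f[OF inj])
    qed auto
    then have "negligible U"
      using inj by (simp add: inv_into_image_cancel)
    moreover have "openin (top_of_set (A w k)) U" "x \<in> U"
      using x by (auto simp: U_def intro!: openin_open_Int)
    ultimately show "\<exists>U. openin (top_of_set (A w k)) U \<and> x \<in> U \<and> negligible U"
      by blast
  qed
  have "{x. F x = 0 \<and> (\<exists>D. (F has_derivative D) (at x) \<and> D \<noteq> (\<lambda>_. 0))} \<subseteq> (\<Union>w\<in>Q-{0}. \<Union>k. A w k)"
  proof safe
    fix x D assume x: "F x = 0" and D: "(F has_derivative D) (at x)" "D \<noteq> (\<lambda>_. 0)"
    define w0 where "w0 = adjoint D 1"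
    have D_eq: "D h = w0 \<bullet> h" for h
      using adjoint_works[OF has_derivative_linear[OF D(1)], of h 1]
      by (simp add: w0_def inner_commute)
    then have w0: "norm w0 > 0" using D(2) by auto
    \<comment> \<open>The errors from density and from differentiability are
      \<open>norm w0 / 8\<close> each. Their sum \<open>norm w0 / 4\<close> stays below
      \<open>norm w / 2\<close> because \<open>norm w\<close> is at least
      \<open>7/8 * norm w0\<close>.\<close>
    then obtain w where w: "w \<in> Q" "w \<in> ball w0 (norm w0 / 8)"
      using Q(2)[of "ball w0 (norm w0 / 8)"] by auto
    then have dw: "norm (w - w0) \<le> norm w0 / 8"
      by (simp add: dist_norm norm_minus_commute)
    then have nw: "norm w \<ge> 7/8 * norm w0"
      using norm_triangle_ineq2[of w0 "w0 - w"] by (simp add: norm_minus_commute)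
    obtain e where e: "e > 0" "\<And>y. norm (y - x) < e \<Longrightarrow>
        norm (F y - F x - D (y - x)) \<le> norm w0 / 8 * norm (y - x)"
      using D(1) w0 unfolding has_derivative_at_alt
      by (metis divide_pos_pos zero_less_numeral)
    obtain k where k: "1 / Suc k < e" using e(1) nat_approx_posE by blast
    have "x \<in> A w k"
      unfolding A_def
    proof (intro CollectI conjI allI impI x)
      fix y assume "norm (y - x) < 1 / real (Suc k)"
      then have "\<bar>F y - w0 \<bullet> (y - x)\<bar> \<le> norm w0 / 8 * norm (y - x)"
        using e(2)[of y] k x by (simp add: D_eq)
      moreover have "\<bar>(w - w0) \<bullet> (y - x)\<bar> \<le> norm w0 / 8 * norm (y - x)"
        using Cauchy_Schwarz_ineq2[of "w - w0" "y - x"] mult_right_mono[OF dw norm_ge_zero[of "y - x"]]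
        by linarith
      ultimately have "\<bar>F y - w \<bullet> (y - x)\<bar> \<le> norm w0 / 4 * norm (y - x)"
        unfolding inner_diff_left by argo
      also have "\<dots> \<le> norm w / 2 * norm (y - x)"
        using nw norm_ge_zero[of w0] by (intro mult_right_mono norm_ge_zero) linarith
      finally show "\<bar>F y - w \<bullet> (y - x)\<bar> \<le> norm w / 2 * norm (y - x)" .
    qed
    moreover have "w \<noteq> 0" using nw w0 by auto
    ultimately show "x \<in> (\<Union>w\<in>Q-{0}. \<Union>k. A w k)"
      using w(1) by blast
  qed
  moreover have "negligible (\<Union>w\<in>Q-{0}. \<Union>k. A w k)"
  proof -
    have "negligible (\<Union> ((\<lambda>(w, k). A w k) ` ((Q - {0}) \<times> UNIV)))"
      using Q(1) neg by (intro negligible_countable_Union) auto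
    moreover have "(\<Union>w\<in>Q-{0}. \<Union>k. A w k) = \<Union> ((\<lambda>(w, k). A w k) ` ((Q - {0}) \<times> UNIV))"
      by auto
    ultimately show ?thesis by simp
  qed
  ultimately show ?thesis by (rule negligible_subset[rotated])
qed

text \<open>For every slope \<open>e > 0\<close> the points at which \<open>y\<close> lies on or
  below the line of slope \<open>e\<close> through \<open>(a, y a)\<close> form a closed set, and
  the Dini bound at its supremum would push the set further to the right unless that supremum is
  \<open>b\<close>. Then \<open>e\<close> tends to 0.\<close>

lemma dini_nonincreasing:
  fixes y :: "real \<Rightarrow> real"
  assumes ab: "a \<le> b" and cont: "continuous_on {a..b} y"
    and dini: "\<And>s e. \<lbrakk>a \<le> s; s < b; e > 0\<rbrakk> \<Longrightarrow> eventually (\<lambda>t. y t \<le> y s + e * (t - s)) (at_right s)"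
  shows "y b \<le> y a"
proof (rule field_le_epsilon)
  fix e' :: real assume "e' > 0"
  \<comment> \<open>The \<open>+ 1\<close> keeps \<open>e\<close> positive when
    \<open>a = b\<close>.\<close>
  define e where "e = e' / (b - a + 1)"
  have e: "e > 0" "e * (b - a) \<le> e'"
    using \<open>e' > 0\<close> ab by (auto simp: e_def field_simps)
  define S where "S = {s \<in> {a..b}. y s - e * (s - a) \<le> y a}"
  have "closed S"
  proof -
    have "continuous_on {a..b} (\<lambda>s. y s - e * (s - a))" by (intro continuous_intros cont)
    then show ?thesis
      using continuous_closed_preimage[of "{a..b}" "\<lambda>s. y s - e * (s - a)" "{..y a}"]
      by (auto simp: S_def vimage_def Int_def)
  qed
  have S: "a \<in> S" "bdd_above S" using ab by (auto simp: S_def)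
  then have \<tau>: "Sup S \<in> S" using \<open>closed S\<close> closed_contains_Sup by blast
  have "Sup S = b"
  proof (rule ccontr)
    assume "Sup S \<noteq> b"
    then have lt: "a \<le> Sup S" "Sup S < b" using \<tau> by (auto simp: S_def)
    from dini[OF this e(1)] obtain q where q: "q > Sup S"
      "\<And>t. Sup S < t \<Longrightarrow> t < q \<Longrightarrow> y t \<le> y (Sup S) + e * (t - Sup S)"
      unfolding eventually_at_right_field by blast
    obtain t where t: "Sup S < t" "t < min q b"
      using q(1) lt dense by (metis min_less_iff_conj)
    then have "y t \<le> y (Sup S) + e * (t - Sup S)" using q by auto
    then have "t \<in> S" using t \<tau> lt by (auto simp: S_def algebra_simps)
    then show False using t S cSup_upper by fastforce
  qed
  then have "y b \<le> y a + e * (b - a)" using \<tau> by (auto simp: S_def)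
  then show "y b \<le> y a + e'" using e by linarith
qed

text \<open>A Gronwall inequality for one-sided derivatives: the integrating factor
  \<open>exp (- K * (s - a))\<close> reduces it to the nonincreasing case. The sign of
  \<open>K\<close> is arbitrary, so it serves both for decay of a Lyapunov function and for
  uniqueness of flows.\<close>

lemma dini_exp_bound:
  fixes y :: "real \<Rightarrow> real"
  assumes ab: "a \<le> b" and cont: "continuous_on {a..b} y"
    and dini: "\<And>s e. \<lbrakk>a \<le> s; s < b; e > 0\<rbrakk> \<Longrightarrow>
      eventually (\<lambda>t. y t \<le> y s + (K * y s + e) * (t - s)) (at_right s)"
  shows "y b \<le> exp (K * (b - a)) * y a"
proof -
  define z where "z s = exp (- K * (s - a)) * y s" for s
  have "z b \<le> z a"
  proof (rule dini_nonincreasing[OF ab])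
    show "continuous_on {a..b} z" unfolding z_def by (intro continuous_intros cont)
    fix s e :: real assume s: "a \<le> s" "s < b" and e: "e > 0"
    \<comment> \<open>Chosen so that the majorant \<open>q\<close>, which touches \<open>z\<close>
      at \<open>s\<close>, has derivative exactly \<open>e / 2\<close> there: the terms with
      \<open>K * y s\<close> cancel and \<open>e'\<close> times the integrating factor
      remains.\<close>
    define e' where "e' = e / (2 * exp (- K * (s - a)))"
    have e': "e' > 0" using e by (simp add: e'_def)
    define q where "q t = exp (- K * (t - a)) * (y s + (K * y s + e') * (t - s))" for t
    have "(q has_real_derivative e / 2) (at s)"
      unfolding q_def
      by (auto intro!: derivative_eq_intros simp: algebra_simps e'_def exp_minus divide_simps)
    then have "((\<lambda>t. (q t - q s) / (t - s)) \<longlongrightarrow> e / 2) (at_right s)"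
      unfolding has_field_derivative_iff by (rule filterlim_mono[OF _ order_refl at_le]) simp
    then have "eventually (\<lambda>t. (q t - q s) / (t - s) < e) (at_right s)"
      using e by (intro order_tendstoD(2)[of _ "e / 2"]) auto
    then show "eventually (\<lambda>t. z t \<le> z s + e * (t - s)) (at_right s)"
      using dini[OF s e'] eventually_at_right_less
    proof eventually_elim
      case (elim t)
      have "z t \<le> q t" unfolding z_def q_def using elim(2) by simp
      also have "q t \<le> q s + e * (t - s)" using elim by (simp add: field_simps)
      also have "q s = z s" by (simp add: q_def z_def)
      finally show ?case .
    qed
  qed
  then have "exp (K * (b - a)) * (exp (- K * (b - a)) * y b) \<le> exp (K * (b - a)) * y a"
    by (simp add: z_def)
  then show ?thesis
    by (simp add: mult.assoc[symmetric] exp_add[symmetric])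
qed

section \<open>From gradient bounds almost everywhere to bounds on increments\<close>

lemma has_derivative_norm_le:
  fixes W :: "'a::real_normed_vector \<Rightarrow> real"
  assumes lip: "\<And>p q. p \<in> ball x r \<Longrightarrow> q \<in> ball x r \<Longrightarrow> \<bar>W p - W q\<bar> \<le> L * norm (p - q)"
    and p: "p \<in> ball x r" and D: "(W has_derivative D) (at p)"
  shows "\<bar>D v\<bar> \<le> L * norm v"
proof -
  have "((\<lambda>t. W (p + t *\<^sub>R v)) has_derivative (\<lambda>t. D (t *\<^sub>R v))) (at 0)"
    by (rule has_derivative_compose[of "\<lambda>t. p + t *\<^sub>R v" "\<lambda>t. t *\<^sub>R v", simplified])
       (auto intro!: derivative_eq_intros D)
  then have "((\<lambda>t. W (p + t *\<^sub>R v)) has_real_derivative D v) (at 0)"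
    by (simp add: has_field_derivative_def linear_scale[OF has_derivative_linear[OF D]] mult_commute_abs)
  then have "((\<lambda>t. (W (p + t *\<^sub>R v) - W p) / t) \<longlongrightarrow> D v) (at 0)"
    by (simp add: has_field_derivative_iff)
  then have "((\<lambda>t. \<bar>(W (p + t *\<^sub>R v) - W p) / t\<bar>) \<longlongrightarrow> \<bar>D v\<bar>) (at 0)"
    by (rule tendsto_rabs)
  moreover have "eventually (\<lambda>t. \<bar>(W (p + t *\<^sub>R v) - W p) / t\<bar> \<le> L * norm v) (at 0)"
  proof -
    have "((\<lambda>t. p + t *\<^sub>R v) \<longlongrightarrow> p + 0 *\<^sub>R v) (at 0)" by (intro tendsto_intros)
    then have "eventually (\<lambda>t. p + t *\<^sub>R v \<in> ball x r) (at 0)"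
      using p by (intro topological_tendstoD) auto
    moreover have "eventually (\<lambda>t::real. t \<noteq> 0) (at 0)" by (simp add: eventually_at_filter)
    ultimately show ?thesis
    proof eventually_elim
      case (elim t)
      then show ?case using lip[OF elim(1) p] by (simp add: field_simps abs_mult)
    qed
  qed
  ultimately show ?thesis by (intro tendsto_upperbound[where F="at (0::real)"]) auto
qed

text \<open>The segment itself may lie in \<open>Z\<close>, so \<open>W\<close> is averaged over its
  translates by a small box. For each fixed parameter \<open>t\<close> only a null set of translates
  moves the point into \<open>Z\<close>; hence the average \<open>\<Phi>\<close> is differentiable
  in \<open>t\<close> with derivative at most \<open>\<kappa>\<close> times the volume of the box.
  Continuity of \<open>W\<close> at the two ends allows the return from the average to the
  segment.\<close>

lemma directional_increment_le:
  fixes W :: "'a::euclidean_space \<Rightarrow> real"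
  assumes lip: "\<And>p q. p \<in> ball x r \<Longrightarrow> q \<in> ball x r \<Longrightarrow> \<bar>W p - W q\<bar> \<le> L * norm (p - q)"
    and Z: "negligible Z"
    and der: "\<And>p. p \<in> ball x r \<Longrightarrow> p \<notin> Z \<Longrightarrow> \<exists>D. (W has_derivative D) (at p) \<and> D v \<le> \<kappa>"
    and h: "0 \<le> h" "h * norm v < r"
  shows "W (x + h *\<^sub>R v) \<le> W x + \<kappa> * h"
proof (rule field_le_epsilon)
  fix \<epsilon> :: real assume \<epsilon>: "\<epsilon> > 0"
  have "r > 0" using h by (meson le_less_trans mult_nonneg_nonneg norm_ge_zero)
  have contW: "continuous_on (ball x r) W"
  proof (rule lipschitz_on_continuous_on)
    show "(max L 0)-lipschitz_on (ball x r) W"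
    proof (rule lipschitz_onI)
      fix p q assume "p \<in> ball x r" "q \<in> ball x r"
      then have "\<bar>W p - W q\<bar> \<le> L * norm (p - q)" by (rule lip)
      also have "\<dots> \<le> max L 0 * norm (p - q)" by (intro mult_right_mono) auto
      finally show "dist (W p) (W q) \<le> max L 0 * dist p q" by (simp add: dist_norm)
    qed simp
  qed
  have seg: "norm (t *\<^sub>R v) \<le> h * norm v" if "t \<in> {0..h}" for t
    using that by (auto intro: mult_right_mono)
  \<comment> \<open>Half of the room that the segment leaves inside the ball, so that every
    translate by at most \<open>\<rho>0\<close> stays where \<open>W\<close> is Lipschitz.\<close>
  define \<rho>0 where "\<rho>0 = (r - h * norm v) / 2"
  have \<rho>0: "\<rho>0 > 0" using h by (simp add: \<rho>0_def)
  have near: "\<exists>\<rho>>0. \<forall>y. norm y \<le> \<rho> \<longrightarrow> \<bar>W (z + y) - W z\<bar> \<le> \<epsilon> / 2" if z: "z \<in> ball x r" for z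
  proof -
    obtain \<delta> where \<delta>: "\<delta> > 0" "\<And>z'. z' \<in> ball x r \<Longrightarrow> dist z' z < \<delta> \<Longrightarrow> dist (W z') (W z) < \<epsilon> / 2"
      using contW[unfolded continuous_on_iff, rule_format, OF z half_gt_zero[OF \<epsilon>]] by blast
    obtain \<delta>' where \<delta>': "\<delta>' > 0" "ball z \<delta>' \<subseteq> ball x r"
      using z open_ball openE by blast
    have "\<bar>W (z + y) - W z\<bar> \<le> \<epsilon> / 2" if "norm y \<le> min \<delta> \<delta>' / 2" for y
    proof -
      have "norm y < \<delta>" "norm y < \<delta>'" using that \<delta>(1) \<delta>'(1) by auto
      then have "z + y \<in> ball x r" using \<delta>'(2) by (intro subsetD[OF \<delta>'(2)]) (simp add: dist_norm)
      then show ?thesis using \<delta>(2)[of "z + y"] \<open>norm y < \<delta>\<close> by (simp add: dist_norm)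
    qed
    then show ?thesis using \<delta>(1) \<delta>'(1) by (intro exI[of _ "min \<delta> \<delta>' / 2"]) auto
  qed
  have zin: "x \<in> ball x r" "x + h *\<^sub>R v \<in> ball x r"
    using h \<open>r > 0\<close> by (auto simp: dist_norm)
  obtain \<rho>1 where \<rho>1: "\<rho>1 > 0" "\<And>y. norm y \<le> \<rho>1 \<Longrightarrow> \<bar>W (x + y) - W x\<bar> \<le> \<epsilon> / 2"
    using near[OF zin(1)] by blast
  obtain \<rho>2 where \<rho>2: "\<rho>2 > 0" "\<And>y. norm y \<le> \<rho>2 \<Longrightarrow> \<bar>W (x + h *\<^sub>R v + y) - W (x + h *\<^sub>R v)\<bar> \<le> \<epsilon> / 2"
    using near[OF zin(2)] by blast
  define \<rho> where "\<rho> = min \<rho>0 (min \<rho>1 \<rho>2)"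
  have "\<rho> > 0" using \<rho>0 \<rho>1 \<rho>2 by (simp add: \<rho>_def)
  then obtain a b :: 'a where ab: "cbox a b \<subseteq> ball 0 \<rho>" "\<forall>i\<in>Basis. a \<bullet> i < b \<bullet> i"
    using open_contains_cbox[of "ball 0 \<rho>" 0] by (metis centre_in_ball open_ball)
  define B where "B = cbox a b"
  define m where "m = measure lborel B"
  have m: "m > 0"
    using ab(2) unfolding m_def B_def by (rule content_pos_lt)
  have const: "integral B (\<lambda>_. k) = k * m" "(\<lambda>_. k) integrable_on B" for k :: real
    by (auto simp: B_def m_def)
  have By: "norm y \<le> \<rho>" if "y \<in> B" for y using that ab by (auto simp: B_def dest!: subsetD)
  have inball: "x + y + t *\<^sub>R v \<in> ball x r" if "y \<in> B" "t \<in> {0..h}" for y t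
  proof -
    have "norm (y + t *\<^sub>R v) \<le> \<rho>0 + h * norm v"
      using By[OF that(1)] seg[OF that(2)] by (intro norm_triangle_le) (auto simp: \<rho>_def)
    also have "\<dots> < r" using \<rho>0 by (simp add: \<rho>0_def field_simps)
    finally show ?thesis using norm_minus_cancel[of "y + t *\<^sub>R v"] by (simp add: dist_norm add.assoc)
  qed
  have contB: "continuous_on B (\<lambda>y. W (x + y + t *\<^sub>R v))" if "t \<in> {0..h}" for t
    by (rule continuous_on_compose2[OF contW]) (use inball that in \<open>auto intro!: continuous_intros\<close>)
  then have intB: "(\<lambda>y. W (x + y + t *\<^sub>R v)) integrable_on B" if "t \<in> {0..h}" for t
    using that by (auto simp: B_def intro: integrable_continuous)
  define \<Phi> where "\<Phi> t = integral B (\<lambda>y. W (x + y + t *\<^sub>R v))" for t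
  have "\<exists>d. (\<Phi> has_real_derivative d) (at t within {0..h}) \<and> d \<le> \<kappa> * m" if t: "t \<in> {0..h}" for t
  proof -
    define Zt where "Zt = (+) (- (x + t *\<^sub>R v)) ` Z"
    have Zt: "negligible Zt" unfolding Zt_def by (rule negligible_translation[OF Z])
    have "\<exists>D. (W has_derivative D) (at (x + y + t *\<^sub>R v)) \<and> D v \<le> \<kappa>" if "y \<in> B - Zt" for y
    proof (rule der)
      show "x + y + t *\<^sub>R v \<notin> Z"
        using that by (auto simp: Zt_def image_iff algebra_simps)
    qed (use inball that t in auto)
    then obtain D where D: "\<And>y. y \<in> B - Zt \<Longrightarrow> (W has_derivative D y) (at (x + y + t *\<^sub>R v))"
      "\<And>y. y \<in> B - Zt \<Longrightarrow> D y v \<le> \<kappa>" by metis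
    have spike: "integral (B - Zt) k = integral B k" "k integrable_on (B - Zt) \<longleftrightarrow> k integrable_on B"
      for k :: "'a \<Rightarrow> real"
      by (intro integral_spike_set integrable_spike_set_eq negligible_subset[OF Zt]; auto)+
    have Dlim: "((\<lambda>\<tau>. (W (x + y + \<tau> *\<^sub>R v) - W (x + y + t *\<^sub>R v)) / (\<tau> - t)) \<longlongrightarrow> D y v) (at t)"
      if "y \<in> B - Zt" for y
    proof -
      have "((\<lambda>\<tau>. W (x + y + \<tau> *\<^sub>R v)) has_derivative (\<lambda>\<tau>. D y (\<tau> *\<^sub>R v))) (at t)"
        by (rule has_derivative_compose[of "\<lambda>\<tau>. x + y + \<tau> *\<^sub>R v" "\<lambda>\<tau>. \<tau> *\<^sub>R v"])
           (use D(1)[OF that] in \<open>auto intro!: derivative_eq_intros\<close>)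
      then have "((\<lambda>\<tau>. W (x + y + \<tau> *\<^sub>R v)) has_real_derivative D y v) (at t)"
        by (simp add: has_field_derivative_def
            linear_scale[OF has_derivative_linear[OF D(1)[OF that]]] mult_commute_abs)
      then show ?thesis by (simp add: has_field_derivative_iff)
    qed
    \<comment> \<open>Besides the limit of the integrals, dominated convergence yields the
      integrability of \<open>\<lambda>y. D y v\<close>, which is not known beforehand. The
      Lipschitz constant supplies the dominating function.\<close>
    have g: "(\<lambda>y. D y v) integrable_on (B - Zt) \<and>
       (\<lambda>k. integral (B - Zt) (\<lambda>y. (W (x + y + X k *\<^sub>R v) - W (x + y + t *\<^sub>R v)) / (X k - t)))
         \<longlonglongrightarrow> integral (B - Zt) (\<lambda>y. D y v)"
      if X: "\<And>k. X k \<in> {0..h} - {t}" "X \<longlonglongrightarrow> t" for X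
    proof -
      note * = dominated_convergence[of "\<lambda>k y. (W (x + y + X k *\<^sub>R v) - W (x + y + t *\<^sub>R v)) / (X k - t)"
          "B - Zt" "\<lambda>_. L * norm v" "\<lambda>y. D y v"]
      have 1: "(\<lambda>y. (W (x + y + X k *\<^sub>R v) - W (x + y + t *\<^sub>R v)) / (X k - t)) integrable_on B - Zt" for k
        unfolding spike using X(1)[of k] t
        by (intro integrable_on_divide integrable_diff intB) auto
      have 2: "(\<lambda>_. L * norm v) integrable_on B - Zt"
        unfolding spike by (rule const)
      have 3: "norm ((W (x + y + X k *\<^sub>R v) - W (x + y + t *\<^sub>R v)) / (X k - t)) \<le> L * norm v"
        if "y \<in> B - Zt" for k y
      proof -
        have "\<bar>W (x + y + X k *\<^sub>R v) - W (x + y + t *\<^sub>R v)\<bar> \<le> L * norm ((X k - t) *\<^sub>R v)"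
          using lip[OF inball inball, of y "X k" y t] that X(1)[of k] t by (simp add: scaleR_diff_left)
        then show ?thesis using X(1)[of k] by (simp add: pos_divide_le_eq ac_simps)
      qed
      have 4: "(\<lambda>k. (W (x + y + X k *\<^sub>R v) - W (x + y + t *\<^sub>R v)) / (X k - t)) \<longlonglongrightarrow> D y v"
        if "y \<in> B - Zt" for y
      proof (rule filterlim_compose[OF Dlim[OF that]])
        show "filterlim X (at t) sequentially"
          using X by (intro filterlim_atI) auto
      qed
      show ?thesis using *[OF 1 2 3 4] by blast
    qed
    have "(\<Phi> has_real_derivative (integral (B - Zt) (\<lambda>y. D y v))) (at t within {0..h})"
      unfolding has_field_derivative_iff tendsto_at_iff_sequentially comp_def
    proof (intro allI impI)
      fix X assume X: "\<forall>i. X i \<in> {0..h} - {t}" "X \<longlonglongrightarrow> t"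
      have "(\<Phi> (X k) - \<Phi> t) / (X k - t)
          = integral (B - Zt) (\<lambda>y. (W (x + y + X k *\<^sub>R v) - W (x + y + t *\<^sub>R v)) / (X k - t))" for k
        unfolding spike \<Phi>_def using X t by (simp add: integral_diff[OF intB intB])
      then show "(\<lambda>k. (\<Phi> (X k) - \<Phi> t) / (X k - t)) \<longlonglongrightarrow> integral (B - Zt) (\<lambda>y. D y v)"
        using g[of X] X by simp
    qed
    \<comment> \<open>A sequence in \<open>{0..h} - {t}\<close> tending to \<open>t\<close> exists
      only for \<open>0 < h\<close>. For \<open>h = 0\<close> every number is a derivative within
      the one-point interval, and \<open>\<kappa> * m\<close> is taken.\<close>
    moreover have "integral (B - Zt) (\<lambda>y. D y v) \<le> \<kappa> * m" if "0 < h"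
    proof -
      have "t islimpt {0..h}" using t that by (simp add: islimpt_Icc)
      then obtain X where "\<And>k. X k \<in> {0..h} - {t}" "X \<longlonglongrightarrow> t"
        unfolding islimpt_sequential by blast
      then have "integral (B - Zt) (\<lambda>y. D y v) \<le> integral (B - Zt) (\<lambda>y. \<kappa>)"
        using g[of X] D(2) by (intro integral_le) (auto simp: spike const)
      also have "\<dots> = \<kappa> * m" by (simp only: spike const)
      finally show ?thesis .
    qed
    moreover have "(\<Phi> has_real_derivative \<kappa> * m) (at t within {0..h})" if "h = 0"
      using that t by (simp add: has_field_derivative_def has_derivative_within_singleton_iff bounded_linear_mult_right)
    ultimately show ?thesis using h(1) by (cases "h = 0") auto
  qed
  then obtain \<Phi>' where \<Phi>': "\<And>t. t \<in> {0..h} \<Longrightarrow> (\<Phi> has_real_derivative \<Phi>' t) (at t within {0..h})"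
     "\<And>t. t \<in> {0..h} \<Longrightarrow> \<Phi>' t \<le> \<kappa> * m" by metis
  obtain t where t: "t \<in> {0..h}" "\<Phi> h - \<Phi> 0 = \<Phi>' t * (h - 0)"
    using mvt_very_simple[of 0 h \<Phi> "\<lambda>t. (*) (\<Phi>' t)"] h(1) \<Phi>'(1)
    by (auto simp: has_field_derivative_def)
  then have *: "\<Phi> h \<le> \<Phi> 0 + \<kappa> * m * h"
    using mult_right_mono[OF \<Phi>'(2)[OF t(1)] h(1)] by simp
  have "(W (x + h *\<^sub>R v) - \<epsilon> / 2) * m \<le> \<Phi> h"
    unfolding \<Phi>_def const(1)[symmetric]
  proof (intro integral_le const intB)
    fix y assume "y \<in> B"
    then have "norm y \<le> \<rho>2" using By[of y] by (simp add: \<rho>_def)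
    moreover have "x + y + h *\<^sub>R v = x + h *\<^sub>R v + y" by simp
    ultimately show "W (x + h *\<^sub>R v) - \<epsilon> / 2 \<le> W (x + y + h *\<^sub>R v)"
      using \<rho>2(2)[of y] by (smt (verit))
  qed (use h in auto)
  moreover have "\<Phi> 0 \<le> (W x + \<epsilon> / 2) * m"
    unfolding \<Phi>_def const(1)[symmetric]
  proof (intro integral_le const intB)
    fix y assume "y \<in> B"
    then have "norm y \<le> \<rho>1" using By[of y] by (simp add: \<rho>_def)
    moreover have "x + y + 0 *\<^sub>R v = x + y" by simp
    ultimately show "W (x + y + 0 *\<^sub>R v) \<le> W x + \<epsilon> / 2"
      using \<rho>1(2)[of y] by (smt (verit))
  qed (use h in auto)
  ultimately have "(W (x + h *\<^sub>R v) - \<epsilon> / 2) * m \<le> (W x + \<epsilon> / 2 + \<kappa> * h) * m"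
    using * by (simp add: algebra_simps)
  then show "W (x + h *\<^sub>R v) \<le> W x + \<kappa> * h + \<epsilon>" using m by simp
qed

section \<open>Caratheodory flows\<close>

text \<open>The integral equation is vacuous for \<open>b < a\<close>, so a flow for all forward
  times can be stated as \<open>flow_on f u x a b\<close> for every \<open>b\<close>.\<close>

definition flow_on :: "('x::euclidean_space \<Rightarrow> 'u::euclidean_space \<Rightarrow> 'x) \<Rightarrow> (real \<Rightarrow> 'u) \<Rightarrow> (real \<Rightarrow> 'x)
    \<Rightarrow> real \<Rightarrow> real \<Rightarrow> bool"
  where "flow_on f u x a b \<longleftrightarrow>
    (\<forall>t\<in>{a..b}. ((\<lambda>\<tau>. f (x \<tau>) (u \<tau>)) has_integral (x t - x a)) {a..t})"

lemma flow_on_continuous: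
  assumes "flow_on f u x a b"
  shows "continuous_on {a..b} x"
proof (cases "a \<le> b")
  case True
  have eq: "x t = x a + integral {a..t} (\<lambda>\<tau>. f (x \<tau>) (u \<tau>))" if "t \<in> {a..b}" for t
    using assms that by (auto simp: flow_on_def dest!: bspec integral_unique)
  have "(\<lambda>\<tau>. f (x \<tau>) (u \<tau>)) integrable_on {a..b}"
    using assms True by (auto simp: flow_on_def)
  then have "continuous_on {a..b} (\<lambda>t. x a + integral {a..t} (\<lambda>\<tau>. f (x \<tau>) (u \<tau>)))"
    by (intro continuous_intros indefinite_integral_continuous_1)
  then show ?thesis by (rule continuous_on_eq) (rule eq[symmetric])
qed auto

lemma flow_on_subinterval:
  assumes fl: "flow_on f u x a b" and sub: "a \<le> a'" "b' \<le> b"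
  shows "flow_on f u x a' b'"
  unfolding flow_on_def
proof
  fix t assume t: "t \<in> {a'..b'}"
  let ?F = "\<lambda>\<tau>. f (x \<tau>) (u \<tau>)"
  have 1: "(?F has_integral (x t - x a)) {a..t}" "(?F has_integral (x a' - x a)) {a..a'}"
    using fl t sub by (auto simp: flow_on_def)
  then have "?F integrable_on {a'..t}"
    using t sub by (auto intro: integrable_subinterval_real)
  moreover have "integral {a..a'} ?F + integral {a'..t} ?F = integral {a..t} ?F"
    using 1 t sub by (intro Henstock_Kurzweil_Integration.integral_combine) auto
  then have "integral {a'..t} ?F = (x t - x a) - (x a' - x a)"
    unfolding integral_unique[OF 1(1)] integral_unique[OF 1(2)] eq_diff_eq by (simp add: add.commute)
  ultimately show "(?F has_integral (x t - x a')) {a'..t}"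
    by (simp add: has_integral_iff)
qed

lemma flow_on_cong:
  assumes "flow_on f u x a b" "\<And>t. t \<in> {a..b} \<Longrightarrow> x t = y t"
    "\<And>t. t \<in> {a..b} \<Longrightarrow> f (x t) (u t) = f' (y t) (u' t)"
  shows "flow_on f' u' y a b"
  unfolding flow_on_def
proof
  fix t assume t: "t \<in> {a..b}"
  then have "((\<lambda>\<tau>. f (x \<tau>) (u \<tau>)) has_integral (x t - x a)) {a..t}"
    using assms(1) by (simp add: flow_on_def)
  moreover have "x t - x a = y t - y a" using t assms(2) by auto
  ultimately show "((\<lambda>\<tau>. f' (y \<tau>) (u' \<tau>)) has_integral (y t - y a)) {a..t}"
    using t assms(3) by (auto elim: has_integral_eq[rotated])
qed

text \<open>Right-continuity of \<open>u\<close> makes the integrand right-continuous, so the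
  fundamental theorem of calculus applies from the right at every \<open>s\<close>, not merely at
  almost every one. Dini comparison does not tolerate exceptional times.\<close>

lemma flow_on_right_derivative:
  assumes fl: "flow_on f u x a b" and s: "a \<le> s" "s < b"
    and cf: "continuous_on UNIV (\<lambda>p. f (fst p) (snd p))"
    and cu: "continuous (at_right s) u"
  shows "(x has_vector_derivative f (x s) (u s)) (at_right s)"
proof -
  let ?F = "\<lambda>\<tau>. f (x \<tau>) (u \<tau>)"
  have fl': "flow_on f u x s b" using s by (intro flow_on_subinterval[OF fl]) auto
  have at: "at s within {s..b} = at_right s" using s by (intro at_within_Icc_at_right)
  have cx: "(x \<longlongrightarrow> x s) (at_right s)"
    using flow_on_continuous[OF fl'] s unfolding continuous_on_def at[symmetric] by auto
  have "((\<lambda>\<tau>. (x \<tau>, u \<tau>)) \<longlongrightarrow> (x s, u s)) (at_right s)"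
    using cx cu by (intro tendsto_intros) (auto simp: continuous_within)
  moreover have "isCont (\<lambda>p. f (fst p) (snd p)) (x s, u s)"
    using cf by (simp add: continuous_on_eq_continuous_at)
  ultimately have "((\<lambda>\<tau>. f (fst (x \<tau>, u \<tau>)) (snd (x \<tau>, u \<tau>))) \<longlongrightarrow> f (fst (x s, u s)) (snd (x s, u s))) (at_right s)"
    by (rule isCont_tendsto_compose[rotated])
  then have cF: "continuous (at s within ({s..b} - {})) ?F"
    by (simp add: continuous_within at)
  have "?F integrable_on {s..b}" using fl' s by (auto simp: flow_on_def)
  from integral_has_vector_derivative_continuous_at[OF this _ _ cF] s
  have "((\<lambda>t. integral {s..t} ?F) has_vector_derivative ?F s) (at s within {s..b})" by simp
  then have "((\<lambda>t. x s + integral {s..t} ?F) has_vector_derivative ?F s) (at s within {s..b})"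
    by (auto intro!: derivative_eq_intros)
  then have "(x has_vector_derivative ?F s) (at s within {s..b})"
  proof (rule has_vector_derivative_transform[rotated 2])
    show "x t = x s + integral {s..t} ?F" if "t \<in> {s..b}" for t
      using fl' that by (auto simp: flow_on_def dest!: bspec integral_unique)
  qed (use s in auto)
  then show ?thesis by (simp add: at)
qed

lemma integrable_along_curve:
  fixes f :: "'x::euclidean_space \<Rightarrow> 'u::euclidean_space \<Rightarrow> 'y::euclidean_space"
  assumes x: "continuous_on {a..b} x"
    and u: "u \<in> borel_measurable (lebesgue_on {a..b})" "bounded (u ` {a..b})"
    and f: "continuous_on UNIV (\<lambda>p. f (fst p) (snd p))"
  shows "(\<lambda>\<tau>. f (x \<tau>) (u \<tau>)) integrable_on {a..b::real}"
proof -
  define K where "K = (x ` {a..b}) \<times> closure (u ` {a..b})"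
  have "compact K"
    unfolding K_def using x u(2) by (intro compact_Times compact_continuous_image) auto
  then have "bounded ((\<lambda>p. f (fst p) (snd p)) ` K)"
    by (intro compact_imp_bounded compact_continuous_image continuous_on_subset[OF f]) auto
  then obtain M where M: "\<And>p. p \<in> K \<Longrightarrow> norm (f (fst p) (snd p)) \<le> M"
    by (auto simp: bounded_iff)
  show ?thesis
  proof (rule measurable_bounded_by_integrable_imp_integrable)
    show "(\<lambda>\<tau>. f (x \<tau>) (u \<tau>)) \<in> borel_measurable (lebesgue_on {a..b})"
      by (rule borel_measurable_continuous_Pair[OF continuous_imp_measurable_on_sets_lebesgue[OF x] u(1) f]) auto
    show "(\<lambda>_. M) integrable_on {a..b}" by (rule integrable_const_ivl)
    show "norm (f (x \<tau>) (u \<tau>)) \<le> M" if "\<tau> \<in> {a..b}" for \<tau>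
      using M[of "(x \<tau>, u \<tau>)"] that subsetD[OF closure_subset[of "u ` {a..b}"], of "u \<tau>"]
      by (auto simp: K_def)
  qed auto
qed

text \<open>The substitution \<open>x(t) = exp (2 L (t - a)) z(t)\<close> makes the Picard operator a contraction
  in the sup norm on the whole interval.\<close>

lemma picard_lipschitz:
  fixes f :: "'x::euclidean_space \<Rightarrow> 'u::euclidean_space \<Rightarrow> 'x"
  assumes ab: "a \<le> b"
    and u: "u \<in> borel_measurable (lebesgue_on {a..b})" "bounded (u ` {a..b})"
    and f: "continuous_on UNIV (\<lambda>p. f (fst p) (snd p))"
    and lip: "\<And>t x y. t \<in> {a..b} \<Longrightarrow> norm (f x (u t) - f y (u t)) \<le> L * norm (x - y)"
  obtains x where "x a = x0" "flow_on f u x a b"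
proof -
  define l where "l = max L 1"
  have l: "l > 0" by (simp add: l_def)
  have lip': "norm (f x (u t) - f y (u t)) \<le> l * norm (x - y)" if "t \<in> {a..b}" for t x y
    using lip[OF that, of x y] mult_right_mono[of L l "norm (x - y)"] by (simp add: l_def)
  define E where "E t = exp (2 * l * (t - a))" for t
  have E: "continuous_on S E" "E t > 0" for S t
    unfolding E_def by (auto intro!: continuous_intros)
  define F where "F z \<tau> = f (E \<tau> *\<^sub>R apply_bcontfun z \<tau>) (u \<tau>)" for z \<tau>
  have intF: "F z integrable_on {a..t}" if "t \<in> {a..b}" for z t
  proof -
    have "F z integrable_on {a..b}"
      unfolding F_def by (intro integrable_along_curve u f continuous_intros E) auto
    then show ?thesis using that by (auto intro: integrable_subinterval_real)
  qed
  \<comment> \<open>Bounded continuous functions live on the whole line, while the integral equation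
    makes sense on \<open>{a..b}\<close> only. Clamping the time extends the Picard image constantly
    on both sides.\<close>
  define cl where "cl t = max a (min b t)" for t
  have cl: "cl t \<in> {a..b}" "t \<in> {a..b} \<Longrightarrow> cl t = t" for t using ab by (auto simp: cl_def)
  define P0 where "P0 z t = (x0 + integral {a..t} (F z)) /\<^sub>R E t" for z t
  have "continuous_on {a..b} (P0 z)" for z
    unfolding P0_def using ab E(2)
    by (intro continuous_intros indefinite_integral_continuous_1 intF E) (auto simp: less_imp_neq[symmetric])
  then have P0: "(\<lambda>t. P0 z (cl t)) \<in> bcontfun" for z
  proof -
    assume c: "\<And>z. continuous_on {a..b} (P0 z)"
    have "continuous_on UNIV (\<lambda>t. P0 z (cl t))"
    proof (rule continuous_on_compose2[OF c])
      show "continuous_on UNIV cl" unfolding cl_def by (intro continuous_intros)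
    qed (use cl in auto)
    moreover have "bounded (P0 z ` {a..b})"
      using c by (intro compact_imp_bounded compact_continuous_image) auto
    then have "bounded (range (\<lambda>t. P0 z (cl t)))"
      using cl by (elim bounded_subset) auto
    ultimately show ?thesis by (simp add: bcontfun_def)
  qed
  define P where "P z = Bcontfun (\<lambda>t. P0 z (cl t))" for z
  have P: "apply_bcontfun (P z) t = P0 z (cl t)" for z t
    unfolding P_def using P0 by (simp add: Bcontfun_inverse)
  have "dist (P z) (P w) \<le> 1/2 * dist z w" for z w
  proof (rule dist_bound)
    fix t0
    define t where "t = cl t0"
    have t: "t \<in> {a..b}" using cl by (simp add: t_def)
    have "norm (integral {a..t} (F z) - integral {a..t} (F w)) = norm (integral {a..t} (\<lambda>\<tau>. F z \<tau> - F w \<tau>))"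
      using t by (simp add: integral_diff intF)
    also have "\<dots> \<le> integral {a..t} (\<lambda>\<tau>. l * E \<tau> * dist z w)"
    proof (rule integral_norm_bound_integral)
      show "(\<lambda>\<tau>. F z \<tau> - F w \<tau>) integrable_on {a..t}" using t by (intro integrable_diff intF)
      show "(\<lambda>\<tau>. l * E \<tau> * dist z w) integrable_on {a..t}"
        by (intro integrable_continuous_real continuous_intros E)
      fix \<tau> assume "\<tau> \<in> {a..t}"
      then have "norm (F z \<tau> - F w \<tau>) \<le> l * norm (E \<tau> *\<^sub>R apply_bcontfun z \<tau> - E \<tau> *\<^sub>R apply_bcontfun w \<tau>)"
        unfolding F_def using t by (intro lip') auto
      also have "\<dots> = l * E \<tau> * dist (apply_bcontfun z \<tau>) (apply_bcontfun w \<tau>)"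
        using E(2)[of \<tau>] by (simp add: dist_norm scaleR_diff_right[symmetric])
      also have "\<dots> \<le> l * E \<tau> * dist z w"
        using E(2)[of \<tau>] l by (intro mult_left_mono dist_bounded) auto
      finally show "norm (F z \<tau> - F w \<tau>) \<le> l * E \<tau> * dist z w" .
    qed
    \<comment> \<open>Since the weight satisfies \<open>E' = 2 * l * E\<close>, integrating
      \<open>l * E\<close> gives half of its increment. Division by \<open>E t\<close> then leaves
      the contraction factor \<open>1/2\<close>, whatever the length of the interval.\<close>
    also have "\<dots> = (E t - 1) / 2 * dist z w"
    proof (rule integral_unique)
      have "((\<lambda>\<tau>. l * E \<tau> * dist z w) has_integral (E t / 2 * dist z w - E a / 2 * dist z w)) {a..t}"
      proof (rule fundamental_theorem_of_calculus)
        show "a \<le> t" using t by auto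
        show "((\<lambda>\<tau>. E \<tau> / 2 * dist z w) has_vector_derivative l * E \<tau> * dist z w) (at \<tau> within {a..t})" for \<tau>
          unfolding E_def has_real_derivative_iff_has_vector_derivative[symmetric]
          by (auto intro!: derivative_eq_intros)
      qed
      then show "((\<lambda>\<tau>. l * E \<tau> * dist z w) has_integral (E t - 1) / 2 * dist z w) {a..t}"
        by (simp add: E_def algebra_simps diff_divide_distrib)
    qed
    also have "\<dots> \<le> E t / 2 * dist z w" by (intro mult_right_mono) auto
    finally have *: "norm (integral {a..t} (F z) - integral {a..t} (F w)) \<le> E t / 2 * dist z w" .
    have "dist (P0 z t) (P0 w t) = norm (integral {a..t} (F z) - integral {a..t} (F w)) / E t"
      using E(2)[of t] by (simp add: P0_def dist_norm scaleR_diff_right[symmetric] divide_inverse_commute)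
    also have "\<dots> \<le> 1/2 * dist z w" using * E(2)[of t] by (simp add: field_simps)
    finally show "dist (apply_bcontfun (P z) t0) (apply_bcontfun (P w) t0) \<le> 1/2 * dist z w"
      by (simp add: P t_def)
  qed
  then obtain z where z: "P z = z" using banach_fix_type[of "1/2" P] by auto
  define x where "x t = E t *\<^sub>R apply_bcontfun z t" for t
  have F: "F z = (\<lambda>\<tau>. f (x \<tau>) (u \<tau>))" by (simp add: fun_eq_iff F_def x_def)
  have x: "x t = x0 + integral {a..t} (\<lambda>\<tau>. f (x \<tau>) (u \<tau>))" if "t \<in> {a..b}" for t
  proof -
    have "apply_bcontfun z t = P0 z t" using P[of z t] cl that by (simp add: z)
    then have "x t = x0 + integral {a..t} (F z)" using E(2)[of t] by (simp add: x_def P0_def)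
    then show ?thesis unfolding F .
  qed
  have "x a = x0 + integral {a..a} (\<lambda>\<tau>. f (x \<tau>) (u \<tau>))" using ab by (intro x) auto
  also have "\<dots> = x0" by simp
  finally have "x a = x0" .
  moreover have "flow_on f u x a b"
    unfolding flow_on_def
  proof
    fix t assume t: "t \<in> {a..b}"
    have "(\<lambda>\<tau>. f (x \<tau>) (u \<tau>)) integrable_on {a..t}"
      using intF[OF t, of z] unfolding F .
    then show "((\<lambda>\<tau>. f (x \<tau>) (u \<tau>)) has_integral (x t - x a)) {a..t}"
      unfolding has_integral_iff x[OF t] \<open>x a = x0\<close> by simp
  qed
  ultimately show ?thesis using that by blast
qed

section \<open>Local Lipschitz continuity and uniform constants on compact sets\<close>

lemma loc_lipschitz_on_continuous:
  assumes "loc_lipschitz_on S h"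
  shows "continuous_on S h"
  unfolding continuous_on_eq_continuous_within
proof
  fix z assume z: "z \<in> S"
  then obtain e L where e: "e > 0" and L: "\<forall>p\<in>ball z e \<inter> S. \<forall>q\<in>ball z e \<inter> S. dist (h p) (h q) \<le> L * dist p q"
    using assms unfolding loc_lipschitz_on_def by blast
  have "((\<lambda>p. dist (h p) (h z)) \<longlongrightarrow> 0) (at z within S)"
  proof (rule tendsto_sandwich[of "\<lambda>_. 0" _ _ "\<lambda>p. L * dist p z"])
    show "eventually (\<lambda>p. dist (h p) (h z) \<le> L * dist p z) (at z within S)"
      unfolding eventually_at using e L z by (intro exI[of _ e]) (auto simp: dist_commute)
    have "((\<lambda>p. L * dist p z) \<longlongrightarrow> L * dist z z) (at z within S)" by (intro tendsto_intros)
    then show "((\<lambda>p. L * dist p z) \<longlongrightarrow> 0) (at z within S)" by simp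
  qed auto
  then show "continuous (at z within S) h"
    unfolding continuous_within by (rule tendsto_dist_iff[THEN iffD2])
qed

text \<open>One constant for all inputs in a compact set is what both Picard iteration and the
  uniqueness argument require, because the input varies in time without being continuous.\<close>

lemma loc_lipschitz_on_compact_imp_lipschitz:
  fixes f :: "'x::metric_space \<Rightarrow> 'u::metric_space \<Rightarrow> 'y::metric_space"
  assumes f: "loc_lipschitz_on UNIV (\<lambda>p. f (fst p) (snd p))" and X: "compact X" and U: "compact U"
  obtains L where "\<And>v. v \<in> U \<Longrightarrow> L-lipschitz_on X (\<lambda>x. f x v)"
proof -
  have cont: "continuous_on UNIV (\<lambda>p. f (fst p) (snd p))" by (rule loc_lipschitz_on_continuous[OF f])
  have "local_lipschitz U X (\<lambda>v x. f x v)"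
  proof (rule local_lipschitzI)
    fix v x
    obtain e L where e: "e > 0" and L: "\<And>p q. p \<in> ball (x, v) e \<Longrightarrow> q \<in> ball (x, v) e \<Longrightarrow>
        dist (f (fst p) (snd p)) (f (fst q) (snd q)) \<le> L * dist p q"
      using f unfolding loc_lipschitz_on_def by (metis Int_UNIV_right UNIV_I)
    \<comment> \<open>The product distance is at most the sum of the two distances, so two radii
      \<open>e/3\<close> fit strictly into a ball of radius \<open>e\<close>.\<close>
    have in_ball: "(x', v') \<in> ball (x, v) e" if "x' \<in> cball x (e/3)" "v' \<in> cball v (e/3)" for x' v'
    proof -
      have "dist (x, v) (x', v') \<le> dist x x' + dist v v'"
        by (simp add: dist_Pair_Pair sqrt_sum_squares_le_sum)
      then show ?thesis using that e by auto
    qed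
    have "(max L 0)-lipschitz_on (cball x (e/3) \<inter> X) (\<lambda>x. f x v')" if "v' \<in> cball v (e/3) \<inter> U" for v'
    proof (rule lipschitz_onI)
      fix p q assume "p \<in> cball x (e/3) \<inter> X" "q \<in> cball x (e/3) \<inter> X"
      then have "dist (f p v') (f q v') \<le> L * dist p q"
        using L[of "(p, v')" "(q, v')"] in_ball that by (simp add: dist_Pair_Pair)
      also have "\<dots> \<le> max L 0 * dist p q" by (intro mult_right_mono) auto
      finally show "dist (f p v') (f q v') \<le> max L 0 * dist p q" .
    qed simp
    then show "\<exists>u>0. \<exists>L. \<forall>t\<in>cball v u \<inter> U. L-lipschitz_on (cball x u \<inter> X) (\<lambda>x. f x t)"
      using e by (intro exI[of _ "e/3"] conjI exI[of _ "max L 0"] ballI) auto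
  qed
  moreover have "continuous_on U (\<lambda>v. f x v)" for x
  proof -
    have "continuous_on U (\<lambda>v. (x, v))" by (intro continuous_intros)
    then show ?thesis using continuous_on_compose2[OF cont, of U "\<lambda>v. (x, v)"] by simp
  qed
  ultimately show ?thesis
    using local_lipschitz_compact_implies_lipschitz[where f = "\<lambda>v x. f x v", OF _ X U] that by blast
qed

section \<open>Decay of a Lyapunov function along solutions\<close>

lemma Kinf_mono: "Kinf \<gamma> \<Longrightarrow> 0 \<le> r \<Longrightarrow> r \<le> s \<Longrightarrow> \<gamma> r \<le> \<gamma> s"
  unfolding Kinf_def by (auto intro: strict_mono_on_leD)

lemma Kinf_nonneg: "Kinf \<gamma> \<Longrightarrow> 0 \<le> r \<Longrightarrow> 0 \<le> \<gamma> r"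
  using Kinf_mono[of \<gamma> 0 r] by (simp add: Kinf_def)

lemma Ncount_add:
  assumes "impulse_times t0 T" "r \<le> s" "s \<le> t"
  shows "Ncount T t r = Ncount T t s + Ncount T s r"
proof -
  have "finite (T \<inter> {..t})" using assms by (simp add: impulse_times_def)
  moreover have "T \<inter> {r<..t} = (T \<inter> {s<..t}) \<union> (T \<inter> {r<..s})" using assms by auto
  ultimately show ?thesis
    unfolding Ncount_def by (simp, subst card_Un_disjoint) (auto elim!: finite_subset[rotated])
qed

lemma is_solution_flow_on:
  assumes "is_solution f g t0 T u x" "t0 \<le> a" "T \<inter> {a<..b} = {}"
  shows "flow_on f u x a b"
  unfolding flow_on_def
proof
  fix t assume t: "t \<in> {a..b}"
  then have "T \<inter> {a<..t} = {}" using assms(3) by auto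
  then show "((\<lambda>\<tau>. f (x \<tau>) (u \<tau>)) has_integral x t - x a) {a..t}"
    using assms t unfolding is_solution_def by auto
qed

lemma impulse_gap_before:
  assumes T: "impulse_times t0 T" and \<tau>: "\<tau> \<in> T"
  obtains a where "t0 \<le> a" "a < \<tau>" "T \<inter> {a<..<\<tau>} = {}"
proof -
  \<comment> \<open>\<open>t0\<close> stands in for the previous impulse when \<open>\<tau>\<close>
    is the first one.\<close>
  define A where "A = insert t0 (T \<inter> {t0<..<\<tau>})"
  have "finite (T \<inter> {..\<tau>})" using T by (simp add: impulse_times_def)
  then have "finite A" "A \<noteq> {}" unfolding A_def by (auto elim: finite_subset[rotated])
  then obtain a where a: "a \<in> A" "\<And>s. s \<in> A \<Longrightarrow> s \<le> a" using Max_in Max_ge by meson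
  have "t0 < \<tau>" using T \<tau> by (auto simp: impulse_times_def)
  then have "t0 \<le> a" "a < \<tau>" using a(1) by (auto simp: A_def)
  moreover have "s \<in> A" if "s \<in> T" "a < s" "s < \<tau>" for s
    using that \<open>t0 \<le> a\<close> by (simp add: A_def)
  then have "T \<inter> {a<..<\<tau>} = {}" using a(2) by (meson Int_iff disjoint_iff greaterThanLessThan_iff not_le)
  ultimately show ?thesis using that by blast
qed

text \<open>Isolates what the stability argument needs, free of the block structure. Lipschitz
  continuity is required only away from the origin: derivatives are estimated only where
  \<open>W\<close> exceeds a nonnegative gain, hence never at the origin.\<close>

locale impulsive_lyapunov =
  fixes f g :: "'x::euclidean_space \<Rightarrow> 'u::euclidean_space \<Rightarrow> 'x"
    and W :: "'x \<Rightarrow> real" and \<gamma> :: "real \<Rightarrow> real" and c d :: real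
  assumes f_lip: "loc_lipschitz_on UNIV (\<lambda>p. f (fst p) (snd p))"
    and W_cont: "continuous_on UNIV W"
    and W_lip: "loc_lipschitz_on (UNIV - {0}) W"
    and W_0: "W 0 = 0" and W_pos: "x \<noteq> 0 \<Longrightarrow> W x > 0"
    and W_unbounded: "filterlim W at_top at_infinity"
    and gain: "Kinf \<gamma>"
    and W_flow: "\<exists>Z\<in>null_sets lebesgue. \<forall>x. x \<notin> Z \<longrightarrow>
        (\<exists>D. (W has_derivative D) (at x) \<and>
             (\<forall>u. W x \<ge> \<gamma> (norm u) \<longrightarrow> D (f x u) \<le> - c * W x))"
    and W_jump: "W (g x u) \<le> max (exp (- d) * W x) (\<gamma> (norm u))"
begin

lemma f_cont: "continuous_on UNIV (\<lambda>p. f (fst p) (snd p))"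
  by (rule loc_lipschitz_on_continuous[OF f_lip])

lemma W_nonneg: "W x \<ge> 0"
  using W_0 W_pos[of x] by (cases "x = 0") auto

text \<open>The input is frozen at its value \<open>v\<close>. Because the hypothesis on
  \<open>W (x s)\<close> is strict, it persists in a ball, so the gradient estimate holds at almost
  all points there, with \<open>f p v\<close> close to the fixed direction \<open>w\<close>. This
  bounds \<open>W\<close> along the straight line in direction \<open>w\<close>, from which the
  solution departs by \<open>o(t - s)\<close>.\<close>

lemma W_dini:
  assumes x: "(x has_vector_derivative f (x s) v) (at_right s)"
    and large: "\<gamma> (norm v) < W (x s)" and e: "e > 0"
  shows "eventually (\<lambda>t. W (x t) \<le> W (x s) + (- c * W (x s) + e) * (t - s)) (at_right s)"
proof -
  define p0 w where "p0 = x s" and "w = f (x s) v"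
  have "p0 \<noteq> 0"
    using large W_0 Kinf_nonneg[OF gain, of "norm v"] by (auto simp: p0_def)
  then obtain e1 L0 where e1: "e1 > 0" and L0: "\<forall>p\<in>ball p0 e1 \<inter> (UNIV - {0}). \<forall>q\<in>ball p0 e1 \<inter> (UNIV - {0}).
      dist (W p) (W q) \<le> L0 * dist p q"
    using W_lip unfolding loc_lipschitz_on_def by blast
  define L where "L = max L0 0"
  have L: "L \<ge> 0" by (simp add: L_def)
  obtain Z where Z: "negligible Z" and der: "\<And>x. x \<notin> Z \<Longrightarrow> \<exists>D. (W has_derivative D) (at x) \<and>
             (\<forall>u. W x \<ge> \<gamma> (norm u) \<longrightarrow> D (f x u) \<le> - c * W x)"
    using W_flow by (auto simp: negligible_iff_null_sets)
  have cW: "(W \<longlongrightarrow> W p0) (nhds p0)"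
    using W_cont by (simp add: continuous_on_eq_continuous_at isCont_def tendsto_nhds_iff)
  have cf: "((\<lambda>p. f p v) \<longlongrightarrow> w) (nhds p0)"
  proof -
    have "continuous_on UNIV (\<lambda>p::'x. (p, v))" by (intro continuous_intros)
    then have "continuous_on UNIV (\<lambda>p. f p v)"
      using continuous_on_compose2[OF f_cont, of UNIV "\<lambda>p. (p, v)"] by simp
    then show ?thesis
      by (simp add: continuous_on_eq_continuous_at isCont_def tendsto_nhds_iff w_def p0_def)
  qed
  have "eventually (\<lambda>p. p \<in> ball p0 (min e1 (norm p0))) (nhds p0)"
    using e1 \<open>p0 \<noteq> 0\<close> by (intro eventually_nhds_in_open) auto
  moreover have "eventually (\<lambda>p. W p > \<gamma> (norm v)) (nhds p0)"
    using cW large by (intro order_tendstoD) (auto simp: p0_def)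
  moreover have "eventually (\<lambda>p. - c * W p < - c * W p0 + e / 4) (nhds p0)"
    using order_tendstoD(2)[OF tendsto_mult[OF tendsto_const[of "- c"] cW]] e by simp
  moreover have "eventually (\<lambda>p. L * norm (w - f p v) < e / 4) (nhds p0)"
  proof -
    have "((\<lambda>p. L * norm (w - f p v)) \<longlongrightarrow> L * norm (w - w)) (nhds p0)"
      by (intro tendsto_intros cf)
    then show ?thesis using e by (intro order_tendstoD) auto
  qed
  ultimately have "eventually (\<lambda>p. p \<in> ball p0 (min e1 (norm p0)) \<and> W p > \<gamma> (norm v) \<and>
      - c * W p < - c * W p0 + e / 4 \<and> L * norm (w - f p v) < e / 4) (nhds p0)"
    by eventually_elim auto
  then obtain r where r: "r > 0" and near: "\<And>p. p \<in> ball p0 r \<Longrightarrow>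
     p \<in> ball p0 (min e1 (norm p0)) \<and> W p > \<gamma> (norm v) \<and>
      - c * W p < - c * W p0 + e / 4 \<and> L * norm (w - f p v) < e / 4"
    unfolding eventually_nhds_metric by (auto simp: dist_commute)
  have lip: "\<bar>W p - W q\<bar> \<le> L * norm (p - q)" if "p \<in> ball p0 r" "q \<in> ball p0 r" for p q
  proof -
    have "p \<in> ball p0 e1 \<inter> (UNIV - {0})" "q \<in> ball p0 e1 \<inter> (UNIV - {0})"
      using near[OF that(1)] near[OF that(2)] by auto
    then have "\<bar>W p - W q\<bar> \<le> L0 * norm (p - q)" using L0 by (auto simp: dist_norm)
    also have "\<dots> \<le> L * norm (p - q)" by (intro mult_right_mono) (auto simp: L_def)
    finally show ?thesis .
  qed
  have der': "\<exists>D. (W has_derivative D) (at p) \<and> D w \<le> - c * W p0 + e / 2"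
    if p: "p \<in> ball p0 r" "p \<notin> Z" for p
  proof -
    obtain D where D: "(W has_derivative D) (at p)" "\<forall>u. W p \<ge> \<gamma> (norm u) \<longrightarrow> D (f p u) \<le> - c * W p"
      using der[OF p(2)] by blast
    have "D w = D (f p v) + D (w - f p v)"
      using linear_add[OF has_derivative_linear[OF D(1)], of "f p v" "w - f p v"] by simp
    also have "\<dots> \<le> - c * W p + L * norm (w - f p v)"
      using D(2) near[OF p(1)] has_derivative_norm_le[OF lip p(1) D(1), of "w - f p v"]
      by (intro add_mono) (auto simp: abs_le_iff)
    also have "\<dots> \<le> - c * W p0 + e / 2" using near[OF p(1)] by simp
    finally show ?thesis using D(1) by blast
  qed
  \<comment> \<open>Half of \<open>e\<close> was spent on the gradient estimate, as two parts
    \<open>e / 4\<close>; the other half pays for the distance between the curve and its tangent.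
    The \<open>+ 1\<close> covers \<open>L = 0\<close>.\<close>
  define e2 where "e2 = e / (2 * (L + 1))"
  have e2: "e2 > 0" "L * e2 \<le> e / 2" using e L by (auto simp: e2_def field_simps)
  have "eventually (\<lambda>t. norm (x t - x s - (t - s) *\<^sub>R w) \<le> e2 * norm (t - s)) (at_right s)"
    using x e2(1) unfolding has_vector_derivative_def has_derivative_within_alt2 w_def by blast
  moreover have "eventually (\<lambda>t. x t \<in> ball p0 r) (at_right s)"
  proof -
    have "continuous (at s within {s<..}) x"
      using x by (rule has_vector_derivative_continuous)
    then show ?thesis
      unfolding continuous_within using r by (intro topological_tendstoD) (auto simp: p0_def)
  qed
  moreover have "eventually (\<lambda>t. (t - s) * norm w < r) (at_right s)"
  proof -
    have "((\<lambda>t. (t - s) * norm w) \<longlongrightarrow> (s - s) * norm w) (at_right s)" by (intro tendsto_intros)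
    then show ?thesis using r by (intro order_tendstoD) auto
  qed
  ultimately show ?thesis using eventually_at_right_less
  proof eventually_elim
    case (elim t)
    have "p0 + (t - s) *\<^sub>R w \<in> ball p0 r" using elim by (simp add: dist_norm)
    then have "W (x t) \<le> W (p0 + (t - s) *\<^sub>R w) + L * norm (x t - (p0 + (t - s) *\<^sub>R w))"
      using lip[OF elim(2)] by (fastforce simp: abs_le_iff)
    moreover have "L * norm (x t - (p0 + (t - s) *\<^sub>R w)) \<le> L * (e2 * (t - s))"
      using elim L by (intro mult_left_mono) (auto simp: p0_def diff_diff_eq)
    moreover have "L * (e2 * (t - s)) \<le> e / 2 * (t - s)"
      using mult_right_mono[OF e2(2), of "t - s"] elim by (simp add: mult.assoc)
    moreover have "W (p0 + (t - s) *\<^sub>R w) \<le> W p0 + (- c * W p0 + e / 2) * (t - s)"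
      using elim by (intro directional_increment_le[OF lip Z der']) auto
    ultimately have "W (x t) \<le> W p0 + (- c * W p0 + e / 2) * (t - s) + e / 2 * (t - s)" by linarith
    also have "\<dots> = W p0 + (- c * W p0 + e) * (t - s)" by (simp add: algebra_simps)
    finally show ?case by (simp add: p0_def)
  qed
qed

lemma flow_decay:
  assumes "a \<le> b" "continuous_on {a..b} x"
    and "\<And>s. a \<le> s \<Longrightarrow> s < b \<Longrightarrow> (x has_vector_derivative f (x s) (u s)) (at_right s)"
    and "\<And>s. a \<le> s \<Longrightarrow> s < b \<Longrightarrow> \<gamma> (norm (u s)) < W (x s)"
  shows "W (x b) \<le> exp (- c * (b - a)) * W (x a)"
proof (rule dini_exp_bound[OF assms(1)])
  show "continuous_on {a..b} (\<lambda>t. W (x t))"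
    by (rule continuous_on_compose2[OF W_cont assms(2)]) auto
  show "eventually (\<lambda>t. W (x t) \<le> W (x s) + (- c * W (x s) + e) * (t - s)) (at_right s)"
    if "a \<le> s" "s < b" "e > 0" for s e
    using that assms by (intro W_dini[where v = "u s"]) auto
qed

text \<open>After the last time \<open>s\<close> with \<open>W (x s) \<le> R\<close> the gain
  condition holds and \<open>W\<close> follows the exponential rate. The factor
  \<open>exp (- c * (b - s))\<close> is kept in the second alternative because it exceeds 1 when
  \<open>c\<close> is negative and \<open>s < b\<close>.\<close>

lemma flow_bound:
  assumes ab: "a \<le> b" and cont: "continuous_on {a..b} x"
    and der: "\<And>s. a \<le> s \<Longrightarrow> s < b \<Longrightarrow> (x has_vector_derivative f (x s) (u s)) (at_right s)"
    and R: "\<And>s. a \<le> s \<Longrightarrow> s < b \<Longrightarrow> \<gamma> (norm (u s)) \<le> R"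
  shows "W (x b) \<le> exp (- c * (b - a)) * W (x a) \<or> (\<exists>s\<in>{a..b}. W (x b) \<le> exp (- c * (b - s)) * R)"
proof -
  define S where "S = {s \<in> {a..b}. W (x s) \<le> R}"
  have contW: "continuous_on {a..b} (\<lambda>t. W (x t))"
    by (rule continuous_on_compose2[OF W_cont cont]) auto
  then have "closed S"
    using continuous_closed_preimage[of "{a..b}" "\<lambda>t. W (x t)" "{..R}"]
    by (auto simp: S_def vimage_def Int_def)
  have decay: "W (x b) \<le> exp (- c * (b - q)) * W (x q)"
    if "a \<le> q" "q \<le> b" "S \<inter> {q..b} = {}" for q
  proof (rule flow_decay)
    show "\<gamma> (norm (u s)) < W (x s)" if "q \<le> s" "s < b" for s
    proof -
      have "s \<notin> S" using that \<open>S \<inter> {q..b} = {}\<close> by auto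
      then have "W (x s) > R" using that \<open>a \<le> q\<close> by (simp add: S_def)
      then show ?thesis using that R[of s] \<open>a \<le> q\<close> by linarith
    qed
  qed (use that der in \<open>auto intro: continuous_on_subset[OF cont]\<close>)
  show ?thesis
  proof (cases "S = {}")
    case True
    then show ?thesis using decay[of a] ab by auto
  next
    case False
    have bdd: "bdd_above S" by (auto simp: S_def)
    define s where "s = Sup S"
    have s: "s \<in> S" using False \<open>closed S\<close> bdd closed_contains_Sup by (auto simp: s_def)
    have "W (x b) \<le> exp (- c * (b - s)) * W (x s)"
    proof (cases "s = b")
      case False
      then have "s < b" "a \<le> s" using s by (auto simp: S_def)
      \<comment> \<open>The strict gain condition may fail at \<open>s\<close> itself, so the decay
        estimate starts at \<open>q > s\<close> and \<open>q\<close> tends to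
        \<open>s\<close>.\<close>
      have "((\<lambda>q. exp (- c * (b - q)) * W (x q)) \<longlongrightarrow> exp (- c * (b - s)) * W (x s)) (at_right s)"
      proof (intro tendsto_intros)
        have "continuous_on {s..b} (\<lambda>t. W (x t))"
          using \<open>a \<le> s\<close> by (intro continuous_on_subset[OF contW]) auto
        then show "((\<lambda>q. W (x q)) \<longlongrightarrow> W (x s)) (at_right s)"
          using \<open>s < b\<close> by (rule continuous_on_Icc_at_rightD)
      qed
      moreover have "eventually (\<lambda>q. W (x b) \<le> exp (- c * (b - q)) * W (x q)) (at_right s)"
        unfolding eventually_at_right_field
      proof (intro exI[of _ b] conjI \<open>s < b\<close> allI impI decay)
        fix q assume q: "s < q" "q < b"
        show "a \<le> q" "q \<le> b" using q \<open>a \<le> s\<close> by auto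
        show "S \<inter> {q..b} = {}" using cSup_upper[OF _ bdd] q by (force simp: s_def)
      qed
      ultimately show ?thesis by (intro tendsto_lowerbound[where F="at_right s"]) auto
    qed simp
    also have "\<dots> \<le> exp (- c * (b - s)) * R" using s by (auto simp: S_def)
    finally show ?thesis using s by (auto simp: S_def)
  qed
qed

lemma flow_on_bound:
  assumes ab: "a \<le> b" and fl: "flow_on f u x a b"
    and rc: "\<And>s. a \<le> s \<Longrightarrow> s < b \<Longrightarrow> continuous (at_right s) u"
    and R: "\<And>s. a \<le> s \<Longrightarrow> s < b \<Longrightarrow> \<gamma> (norm (u s)) \<le> R"
  shows "W (x b) \<le> exp (- c * (b - a)) * W (x a) \<or> (\<exists>s\<in>{a..b}. W (x b) \<le> exp (- c * (b - s)) * R)"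
  using flow_on_right_derivative[OF fl _ _ f_cont rc] flow_on_continuous[OF fl] R
  by (intro flow_bound[OF ab]) auto

text \<open>At an impulse time \<open>x b\<close> is already the value after the jump. Redefining it
  there as the left limit gives a curve that is continuous up to \<open>b\<close> and has the same
  right derivatives before \<open>b\<close>, so \<open>flow_bound\<close> applies.\<close>

lemma left_limit_bound:
  assumes ab: "a < b" and fl: "\<And>t. t < b \<Longrightarrow> flow_on f u x a t"
    and xl: "(x \<longlongrightarrow> xl) (at_left b)"
    and rc: "\<And>s. a \<le> s \<Longrightarrow> s < b \<Longrightarrow> continuous (at_right s) u"
    and R: "\<And>s. a \<le> s \<Longrightarrow> s < b \<Longrightarrow> \<gamma> (norm (u s)) \<le> R"
  shows "W xl \<le> exp (- c * (b - a)) * W (x a) \<or> (\<exists>s\<in>{a..b}. W xl \<le> exp (- c * (b - s)) * R)"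
proof -
  define z where "z t = (if t < b then x t else xl)" for t
  have der: "(z has_vector_derivative f (z s) (u s)) (at_right s)" if s: "a \<le> s" "s < b" for s
  proof -
    have "(x has_vector_derivative f (x s) (u s)) (at_right s)"
      using s by (intro flow_on_right_derivative[OF fl[of "(s + b) / 2"] _ _ f_cont rc]) auto
    then have "(x has_vector_derivative f (x s) (u s)) (at s within {s..})"
      by (simp add: at_within_Ici_at_right)
    then have "(z has_vector_derivative f (x s) (u s)) (at s within {s..})"
      by (rule has_vector_derivative_transform_within[of _ _ _ _ "b - s"])
         (use s in \<open>auto simp: z_def dist_real_def\<close>)
    then show ?thesis using s by (simp add: at_within_Ici_at_right z_def)
  qed
  have "continuous_on {a..b} z"
  proof (rule continuous_on_IccI[OF _ _ _ ab])
    show "(z \<longlongrightarrow> z a) (at_right a)"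
      using has_vector_derivative_continuous[OF der[of a]] ab by (simp add: continuous_within)
    have "eventually (\<lambda>t. x t = z t) (at_left b)"
      by (simp add: eventually_at_filter z_def)
    then show "(z \<longlongrightarrow> z b) (at_left b)"
      using xl tendsto_cong[of x z] by (simp add: z_def[of b])
    fix s assume s: "a < s" "s < b"
    have "continuous_on {a..(s + b) / 2} x" using s by (intro flow_on_continuous[OF fl]) auto
    then have "isCont x s"
      using s by (intro continuous_on_interior[of "{a..(s + b) / 2}"]) auto
    moreover have "eventually (\<lambda>t. t < b) (at s)"
      using s by (intro order_tendstoD[OF tendsto_ident_at]) auto
    then have "eventually (\<lambda>t. x t = z t) (at s)" by eventually_elim (simp add: z_def)
    ultimately show "(z \<longlongrightarrow> z s) (at s)"
      using s tendsto_cong[of x z] by (simp add: isCont_def z_def[of s])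
  qed
  from flow_bound[OF less_imp_le[OF ab] this der R] show ?thesis
    using ab by (simp add: z_def)
qed

text \<open>\<open>E t s\<close> is the factor accumulated by flow and impulses over
  \<open>(s, t]\<close>. Whenever \<open>W\<close> drops to the level \<open>\<gamma> U\<close>, or
  a jump lands there, the earlier history is forgotten and everything later contributes one factor
  \<open>E t s \<le> exp \<mu>\<close>. Thus the input term does not accumulate with the number of
  impulses.\<close>

lemma solution_bound:
  assumes sol: "is_solution f g t0 T u x" and T: "T \<in> seq_class t0 c d \<mu> lam"
    and u: "admissible_input t0 u" and lam: "lam > 0"
    and b: "t0 \<le> b" and U: "\<And>s. s \<in> {t0..b} \<Longrightarrow> norm (u s) \<le> U"
  shows "W (x b) \<le> max (exp (\<mu> - lam * (b - t0)) * W (x t0)) (exp \<mu> * \<gamma> U)"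
proof -
  define E where "E t s = exp (- c * (t - s) - d * real (Ncount T t s))" for t s
  define Q where "Q a \<longleftrightarrow> (\<forall>t\<ge>a. E t a * W (x a) \<le> max (E t t0 * W (x t0)) (exp \<mu> * \<gamma> U))" for a
  \<comment> \<open>Quantifying over all final times \<open>t\<close> makes \<open>Q\<close> inductive: the class condition on the impulse
    times bounds \<open>E t s\<close> only as a whole, not factor by factor.\<close>
  have imp: "impulse_times t0 T" using T by (simp add: seq_class_def)
  have E_pos: "E t s > 0" for t s by (simp add: E_def)
  have "U \<ge> 0" using U[of t0] b norm_ge_zero[of "u t0"] by (meson atLeastAtMost_iff order_refl order_trans)
  have R: "\<gamma> (norm v) \<le> \<gamma> U" if "norm v \<le> U" for v :: 'u
    using that by (intro Kinf_mono[OF gain]) auto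
  have R0: "\<gamma> U \<ge> 0" using Kinf_nonneg[OF gain \<open>U \<ge> 0\<close>] .
  have E_le: "E t s \<le> exp (\<mu> - lam * (t - s))" if "t0 \<le> s" "s \<le> t" for s t
    using T that by (force simp: E_def seq_class_def algebra_simps)
  have E_mu: "E t s \<le> exp \<mu>" if "t0 \<le> s" "s \<le> t" for s t
    using E_le[OF that] lam that by (elim order_trans) simp
  have E_mult: "E t s * E s r = E t r" if "r \<le> s" "s \<le> t" for t s r
    unfolding E_def Ncount_add[OF imp that] exp_add[symmetric] by (simp add: algebra_simps)
  have E_flow: "E t s = exp (- c * (t - s))" if "T \<inter> {s<..t} = {}" for t s
    using that by (simp add: E_def Ncount_def)
  have rc: "continuous (at_right s) u" if "t0 \<le> s" for s
    using u that by (simp add: admissible_input_def)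
  have flow_step: "Q t" if Qa: "Q a" and a: "t0 \<le> a" "a \<le> t" "t \<le> b" and no: "T \<inter> {a<..t} = {}" for a t
    unfolding Q_def
  proof (intro allI impI)
    fix t' assume t': "t \<le> t'"
    have "W (x t) \<le> exp (- c * (t - a)) * W (x a) \<or> (\<exists>s\<in>{a..t}. W (x t) \<le> exp (- c * (t - s)) * \<gamma> U)"
      using a by (intro flow_on_bound[OF a(2) is_solution_flow_on[OF sol a(1) no]] rc R U) auto
    then show "E t' t * W (x t) \<le> max (E t' t0 * W (x t0)) (exp \<mu> * \<gamma> U)"
    proof
      assume "W (x t) \<le> exp (- c * (t - a)) * W (x a)"
      then have "E t' t * W (x t) \<le> E t' t * (E t a * W (x a))"
        using E_pos by (simp add: E_flow[OF no])
      also have "\<dots> = E t' a * W (x a)" using E_mult[of a t t'] a t' by (simp add: mult.assoc[symmetric])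
      also have "\<dots> \<le> max (E t' t0 * W (x t0)) (exp \<mu> * \<gamma> U)"
        using Qa a t' by (simp add: Q_def)
      finally show ?thesis .
    next
      assume "\<exists>s\<in>{a..t}. W (x t) \<le> exp (- c * (t - s)) * \<gamma> U"
      then obtain s where s: "s \<in> {a..t}" "W (x t) \<le> exp (- c * (t - s)) * \<gamma> U" by blast
      have "T \<inter> {s<..t} = {}" using no s by auto
      then have "E t' t * W (x t) \<le> E t' t * (E t s * \<gamma> U)"
        using E_pos s by (simp add: E_flow)
      also have "\<dots> = E t' s * \<gamma> U" using E_mult[of s t t'] s t' by (simp add: mult.assoc[symmetric])
      also have "\<dots> \<le> exp \<mu> * \<gamma> U" using s a t' R0 by (intro mult_right_mono E_mu) auto
      finally show ?thesis by simp
    qed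
  qed
  have jump_step: "Q \<tau>" if Qa: "Q a" and a: "t0 \<le> a" "a < \<tau>" "\<tau> \<le> b" and \<tau>: "\<tau> \<in> T"
    and no: "T \<inter> {a<..<\<tau>} = {}" for a \<tau>
    unfolding Q_def
  proof (intro allI impI)
    fix t' assume t': "\<tau> \<le> t'"
    obtain xl ul where lim: "(x \<longlongrightarrow> xl) (at_left \<tau>)" "(u \<longlongrightarrow> ul) (at_left \<tau>)" "x \<tau> = g xl ul"
      using sol \<tau> unfolding is_solution_def by blast
    have "norm ul \<le> U"
    proof (rule tendsto_upperbound[OF tendsto_norm[OF lim(2)]])
      show "eventually (\<lambda>s. norm (u s) \<le> U) (at_left \<tau>)"
        unfolding eventually_at_left_field using a by (intro exI[of _ a]) (auto intro: U)
    qed simp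
    have E_jump: "E t' \<tau> * exp (- d) * exp (- c * (\<tau> - s)) = E t' s" if "a \<le> s" "s < \<tau>" for s
    proof -
      have "T \<inter> {s<..\<tau>} = {\<tau>}" using no that \<tau> by force
      then have "E \<tau> s = exp (- d) * exp (- c * (\<tau> - s))"
        by (simp add: E_def Ncount_def exp_add[symmetric])
      then show ?thesis using E_mult[of s \<tau> t'] that t' by (simp add: mult.assoc)
    qed
    \<comment> \<open>\<open>E t' \<tau>\<close> does not count the impulse at
      \<open>\<tau>\<close>, so the class condition at \<open>\<tau>\<close> says nothing about the
      extra factor \<open>exp (- d)\<close>. The bound is the limit of those for
      \<open>E t' s\<close> as \<open>s\<close> increases to \<open>\<tau>\<close>.\<close>
    have E_left: "E t' \<tau> * exp (- d) \<le> exp \<mu>"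
    proof -
      have "((\<lambda>s. E t' \<tau> * exp (- d) * exp (- c * (\<tau> - s))) \<longlongrightarrow> E t' \<tau> * exp (- d) * exp (- c * (\<tau> - \<tau>))) (at_left \<tau>)"
        by (intro tendsto_intros)
      moreover have "eventually (\<lambda>s. E t' \<tau> * exp (- d) * exp (- c * (\<tau> - s)) \<le> exp \<mu>) (at_left \<tau>)"
        unfolding eventually_at_left_field
      proof (intro exI[of _ a] conjI allI impI a(2))
        fix s assume s: "a < s" "s < \<tau>"
        show "E t' \<tau> * exp (- d) * exp (- c * (\<tau> - s)) \<le> exp \<mu>"
          unfolding E_jump[OF less_imp_le[OF s(1)] s(2)] using a s t' by (intro E_mu) auto
      qed
      ultimately show ?thesis by (auto dest: tendsto_upperbound)
    qed
    have "W xl \<le> exp (- c * (\<tau> - a)) * W (x a) \<or> (\<exists>s\<in>{a..\<tau>}. W xl \<le> exp (- c * (\<tau> - s)) * \<gamma> U)"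
      using a no by (intro left_limit_bound[where u = u] is_solution_flow_on[OF sol] lim rc R U) auto
    then have *: "E t' \<tau> * (exp (- d) * W xl) \<le> max (E t' t0 * W (x t0)) (exp \<mu> * \<gamma> U)"
    proof
      assume "W xl \<le> exp (- c * (\<tau> - a)) * W (x a)"
      then have "E t' \<tau> * exp (- d) * W xl \<le> E t' \<tau> * exp (- d) * (exp (- c * (\<tau> - a)) * W (x a))"
        using E_pos by (intro mult_left_mono) (auto intro: less_imp_le)
      also have "\<dots> = E t' a * W (x a)" using E_jump[of a] a by (simp add: mult.assoc[symmetric])
      also have "\<dots> \<le> max (E t' t0 * W (x t0)) (exp \<mu> * \<gamma> U)"
        using Qa a t' by (simp add: Q_def)
      finally show ?thesis by (simp add: mult.assoc)
    next
      assume "\<exists>s\<in>{a..\<tau>}. W xl \<le> exp (- c * (\<tau> - s)) * \<gamma> U"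
      then obtain s where s: "s \<in> {a..\<tau>}" "W xl \<le> exp (- c * (\<tau> - s)) * \<gamma> U" by blast
      then have "E t' \<tau> * exp (- d) * W xl \<le> E t' \<tau> * exp (- d) * (exp (- c * (\<tau> - s)) * \<gamma> U)"
        using E_pos by (intro mult_left_mono) (auto intro: less_imp_le)
      also have "\<dots> = (E t' \<tau> * exp (- d) * exp (- c * (\<tau> - s))) * \<gamma> U" by (simp add: mult.assoc)
      also have "\<dots> \<le> exp \<mu> * \<gamma> U"
      proof (intro mult_right_mono R0)
        show "E t' \<tau> * exp (- d) * exp (- c * (\<tau> - s)) \<le> exp \<mu>"
        proof (cases "s = \<tau>")
          case True
          then show ?thesis using E_left by simp
        next
          case False
          then have "a \<le> s" "s < \<tau>" using s by auto
          then show ?thesis unfolding E_jump[OF \<open>a \<le> s\<close> \<open>s < \<tau>\<close>] using a t' by (intro E_mu) auto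
        qed
      qed
      finally show ?thesis by (simp add: mult.assoc)
    qed
    have "W (x \<tau>) \<le> max (exp (- d) * W xl) (\<gamma> U)"
      using W_jump[of xl ul] R[OF \<open>norm ul \<le> U\<close>] by (auto simp: lim(3))
    then show "E t' \<tau> * W (x \<tau>) \<le> max (E t' t0 * W (x t0)) (exp \<mu> * \<gamma> U)"
    proof (cases "W (x \<tau>) \<le> exp (- d) * W xl")
      case True
      then have "E t' \<tau> * W (x \<tau>) \<le> E t' \<tau> * (exp (- d) * W xl)"
        using E_pos by (intro mult_left_mono) (auto intro: less_imp_le)
      then show ?thesis using * by linarith
    next
      case False
      then have "E t' \<tau> * W (x \<tau>) \<le> exp \<mu> * \<gamma> U"
        using \<open>W (x \<tau>) \<le> max (exp (- d) * W xl) (\<gamma> U)\<close> a t' W_nonneg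
        by (intro mult_mono E_mu) auto
      then show ?thesis by simp
    qed
  qed
  have "Q t" if "t0 \<le> t" "t \<le> b" for t
    using that
  proof (induction "Ncount T t t0" arbitrary: t rule: less_induct)
    case less
    have fin: "finite (T \<inter> {t0<..t})"
      using imp by (auto simp: impulse_times_def intro: finite_subset[of _ "T \<inter> {..t}"])
    have Q0: "Q t0" by (auto simp: Q_def)
    show ?case
    proof (cases "T \<inter> {t0<..t} = {}")
      case True
      then show ?thesis using flow_step[OF Q0] less.prems by auto
    next
      case False
      define \<tau> where "\<tau> = Max (T \<inter> {t0<..t})"
      have \<tau>: "\<tau> \<in> T" "t0 < \<tau>" "\<tau> \<le> t" using Max_in[OF fin False] by (auto simp: \<tau>_def)
      have after: "T \<inter> {\<tau><..t} = {}"
        using Max_ge[OF fin] \<tau>(2) by (force simp: \<tau>_def[symmetric])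
      \<comment> \<open>Fewer impulses lie before \<open>a\<close> than before \<open>t\<close>, so
        the induction hypothesis gives \<open>Q a\<close>. One jump step to the last impulse
        \<open>\<tau>\<close> and one flow step then reach \<open>t\<close>.\<close>
      obtain a where a: "t0 \<le> a" "a < \<tau>" and between: "T \<inter> {a<..<\<tau>} = {}"
        using impulse_gap_before[OF imp \<tau>(1)] .
      have "\<tau> \<in> T \<inter> {t0<..t} - T \<inter> {t0<..a}" "T \<inter> {t0<..a} \<subseteq> T \<inter> {t0<..t}"
        using \<tau> a by auto
      then have "T \<inter> {t0<..a} \<subset> T \<inter> {t0<..t}" by blast
      then have "Ncount T a t0 < Ncount T t t0"
        unfolding Ncount_def by (rule psubset_card_mono[OF fin])
      then have "Q a" using less.hyps[of a] less.prems a \<tau> by auto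
      then have "Q \<tau>" using jump_step[of a \<tau>] a \<tau> between less.prems by auto
      then show ?thesis using flow_step[of \<tau> t] after \<tau> less.prems by auto
    qed
  qed
  then have "E b b * W (x b) \<le> max (E b t0 * W (x t0)) (exp \<mu> * \<gamma> U)"
    using b by (auto simp: Q_def)
  moreover have "E b t0 * W (x t0) \<le> exp (\<mu> - lam * (b - t0)) * W (x t0)"
    using b by (intro mult_right_mono E_le W_nonneg) auto
  ultimately show ?thesis by (simp add: E_def Ncount_def)
qed

end

section \<open>Existence of global solutions\<close>

lemma admissible_input_bounded:
  assumes "admissible_input t0 u"
  obtains U where "U \<ge> 0" "\<And>s. s \<in> {t0..b} \<Longrightarrow> norm (u s) \<le> U"
proof -
  have "bounded (u ` {t0..b})" using assms by (simp add: admissible_input_def)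
  then obtain U where "\<forall>s\<in>{t0..b}. norm (u s) \<le> U" by (auto simp: bounded_iff)
  then show ?thesis by (intro that[of "max U 0"]) (auto simp: le_max_iff_disj)
qed

lemma admissible_input_measurable:
  assumes "admissible_input t0 u" "t0 \<le> a"
  shows "u \<in> borel_measurable (lebesgue_on {a..b})"
proof -
  have "(\<lambda>t. indicator {t0..} t *\<^sub>R u t) \<in> borel_measurable (lebesgue_on {a..b})"
    using assms(1) unfolding admissible_input_def set_borel_measurable_def
    by (intro measurable_restrict_space1) auto
  then show ?thesis
    by (rule measurable_cong[THEN iffD1, rotated]) (use assms(2) in auto)
qed

context impulsive_lyapunov
begin

text \<open>On the compact ranges of the two curves and of the input, \<open>f\<close> is Lipschitz
  in the state, so the norm of the difference grows at most at rate \<open>L\<close> from the value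
  0.\<close>

lemma flow_unique:
  assumes x: "flow_on f u x a b" and y: "flow_on f u y a b" and ab: "a \<le> b" and eq: "x a = y a"
    and rc: "\<And>s. a \<le> s \<Longrightarrow> s < b \<Longrightarrow> continuous (at_right s) u"
    and bdd: "bounded (u ` {a..b})"
  shows "x b = y b"
proof -
  have cont: "continuous_on {a..b} x" "continuous_on {a..b} y"
    using x y by (auto intro: flow_on_continuous)
  have "compact (x ` {a..b} \<union> y ` {a..b})" "compact (closure (u ` {a..b}))"
    using bdd by (auto intro!: compact_Un compact_continuous_image cont)
  from loc_lipschitz_on_compact_imp_lipschitz[OF f_lip this]
  obtain L where L: "\<And>v. v \<in> closure (u ` {a..b}) \<Longrightarrow> L-lipschitz_on (x ` {a..b} \<union> y ` {a..b}) (\<lambda>p. f p v)"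
    by blast
  define z where "z t = x t - y t" for t
  have "norm (z b) \<le> exp (L * (b - a)) * norm (z a)"
  proof (rule dini_exp_bound[OF ab])
    show "continuous_on {a..b} (\<lambda>t. norm (z t))" unfolding z_def by (intro continuous_intros cont)
    fix s e :: real assume s: "a \<le> s" "s < b" and e: "e > 0"
    define w where "w = f (x s) (u s) - f (y s) (u s)"
    have "u s \<in> closure (u ` {a..b})" using s by (intro subsetD[OF closure_subset]) auto
    then have w: "norm w \<le> L * norm (z s)"
      using s lipschitz_onD[OF L, of "u s" "x s" "y s"] by (auto simp: w_def z_def dist_norm)
    have "(z has_vector_derivative w) (at_right s)"
      unfolding z_def w_def using s x y
      by (intro has_vector_derivative_diff flow_on_right_derivative[OF _ _ _ f_cont] rc) auto
    then have "eventually (\<lambda>t. norm (z t - z s - (t - s) *\<^sub>R w) \<le> e * norm (t - s)) (at_right s)"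
      using e unfolding has_vector_derivative_def has_derivative_within_alt2 by blast
    then show "eventually (\<lambda>t. norm (z t) \<le> norm (z s) + (L * norm (z s) + e) * (t - s)) (at_right s)"
      using eventually_at_right_less
    proof eventually_elim
      case (elim t)
      have "norm (z t) \<le> norm (z s) + norm ((t - s) *\<^sub>R w) + norm (z t - z s - (t - s) *\<^sub>R w)"
        using norm_triangle_ineq[of "z s + (t - s) *\<^sub>R w" "z t - z s - (t - s) *\<^sub>R w"]
          norm_triangle_ineq[of "z s" "(t - s) *\<^sub>R w"] by simp
      moreover have "norm ((t - s) *\<^sub>R w) \<le> (t - s) * (L * norm (z s))"
        using elim w by (simp add: mult_left_mono)
      ultimately show ?case using elim by (simp add: algebra_simps)
    qed
  qed
  then show ?thesis using eq by (simp add: z_def)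
qed

text \<open>Precomposing \<open>f\<close> with the projection onto a large ball makes it globally Lipschitz in the
  state; the Lyapunov bound shows that the solution never reaches the boundary of that ball.\<close>

lemma flow_exists_interval:
  assumes u: "admissible_input t0 u" and a: "t0 \<le> a" "a \<le> b"
  obtains x where "x a = x0" "flow_on f u x a b"
proof -
  obtain U where U: "U \<ge> 0" "\<And>s. s \<in> {t0..b} \<Longrightarrow> norm (u s) \<le> U"
    using admissible_input_bounded[OF u] by blast
  \<comment> \<open>Dominates both alternatives of \<open>flow_bound\<close> on all of
    \<open>{a..b}\<close>; the absolute value serves either sign of \<open>c\<close>. Radial
    unboundedness turns this level into the radius \<open>r\<close> below.\<close>
  define M where "M = exp (\<bar>c\<bar> * (b - a)) * max (W x0) (\<gamma> U)"
  have rc: "continuous (at_right s) u" if "a \<le> s" for s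
    using u a that by (simp add: admissible_input_def)
  have "eventually (\<lambda>x. W x > M) at_infinity"
    using W_unbounded by (simp add: filterlim_at_top_dense)
  then obtain r where r: "\<And>x. norm x \<ge> r \<Longrightarrow> W x > M" unfolding eventually_at_infinity by blast
  have M: "exp (- c * h) * w \<le> M" if "h \<in> {0..b - a}" "w \<le> max (W x0) (\<gamma> U)" for h w
  proof -
    have "- c * h \<le> \<bar>c\<bar> * h" using that by (intro mult_right_mono) auto
    also have "\<dots> \<le> \<bar>c\<bar> * (b - a)" using that by (intro mult_left_mono) auto
    finally have "exp (- c * h) * w \<le> exp (- c * h) * max (W x0) (\<gamma> U)"
      "exp (- c * h) * max (W x0) (\<gamma> U) \<le> M"
      unfolding M_def using that W_nonneg[of x0] by (auto intro!: mult_left_mono mult_right_mono)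
    then show ?thesis by linarith
  qed
  have x0: "norm x0 < r" using r[of x0] M[of 0 "W x0"] a by (cases "norm x0 \<ge> r") auto
  then have "r > 0" using norm_ge_zero[of x0] by linarith
  define pr :: "'x \<Rightarrow> 'x" where "pr = closest_point (cball 0 r)"
  have pr_in: "pr x \<in> cball 0 r" for x
    unfolding pr_def using \<open>r > 0\<close> by (intro closest_point_in_set) auto
  have pr_id: "pr x = x" if "norm x \<le> r" for x
    unfolding pr_def using that by (intro closest_point_self) auto
  have pr_lip: "dist (pr x) (pr y) \<le> dist x y" for x y
    unfolding pr_def using \<open>r > 0\<close> by (intro closest_point_lipschitz) auto
  have pr_cont: "continuous_on S pr" for S
    unfolding pr_def using \<open>r > 0\<close> by (intro continuous_on_closest_point) auto
  have cf: "continuous_on UNIV (\<lambda>p. f (pr (fst p)) (snd p))"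
  proof -
    have "continuous_on UNIV (\<lambda>p::'x \<times> 'u. (pr (fst p), snd p))"
      by (intro continuous_on_Pair continuous_on_compose2[OF pr_cont] continuous_intros) auto
    then show ?thesis using continuous_on_compose2[OF f_cont] by fastforce
  qed
  obtain L where L: "\<And>v. v \<in> cball 0 U \<Longrightarrow> L-lipschitz_on (cball 0 r) (\<lambda>p. f p v)"
    using loc_lipschitz_on_compact_imp_lipschitz[OF f_lip compact_cball compact_cball] by blast
  have lip: "norm (f (pr p) (u t) - f (pr q) (u t)) \<le> L * norm (p - q)" if "t \<in> {a..b}" for t p q
  proof -
    have ut: "u t \<in> cball 0 U" using that a U(2)[of t] by auto
    have "norm (f (pr p) (u t) - f (pr q) (u t)) \<le> L * dist (pr p) (pr q)"
      using lipschitz_onD[OF L[OF ut] pr_in[of p] pr_in[of q]] by (simp add: dist_norm)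
    also have "\<dots> \<le> L * dist p q"
      using lipschitz_on_nonneg[OF L[OF ut]] by (intro mult_left_mono pr_lip)
    finally show ?thesis by (simp add: dist_norm)
  qed
  have "bounded (u ` {a..b})"
    using U(2) a by (intro boundedI[of _ U]) auto
  from picard_lipschitz[OF a(2) admissible_input_measurable[OF u a(1)] this cf lip]
  obtain x where x: "x a = x0" "flow_on (\<lambda>x. f (pr x)) u x a b" by blast
  have cont: "continuous_on {a..b} x" by (rule flow_on_continuous[OF x(2)])
  have inside: "norm (x t) < r" if t: "t \<in> {a..b}" for t
  proof (rule ccontr)
    assume "\<not> norm (x t) < r"
    define S where "S = {t \<in> {a..b}. norm (x t) \<in> {r..}}"
    have "t \<in> S" using t \<open>\<not> norm (x t) < r\<close> by (auto simp: S_def)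
    have "closed S"
      using continuous_closed_preimage[OF continuous_on_norm[OF cont], of "{r..}"]
      by (auto simp: S_def vimage_def Int_def)
    have bdd: "bdd_below S" by (auto simp: S_def)
    \<comment> \<open>The first time the sphere is reached. Before it \<open>pr\<close> is the
      identity along the curve, so the Lyapunov estimate for the original field holds up to
      \<open>\<tau>\<close> and contradicts the choice of \<open>r\<close>.\<close>
    define \<tau> where "\<tau> = Inf S"
    have \<tau>: "\<tau> \<in> S" unfolding \<tau>_def using \<open>t \<in> S\<close> by (intro closed_contains_Inf \<open>closed S\<close> bdd) auto
    have before: "norm (x s) < r" if "a \<le> s" "s < \<tau>" for s
    proof -
      have "s \<notin> S" using that cInf_lower[OF _ bdd, of s] by (auto simp: \<tau>_def)
      then show ?thesis using that \<tau> by (auto simp: S_def)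
    qed
    have "W (x \<tau>) \<le> exp (- c * (\<tau> - a)) * W (x a) \<or> (\<exists>s\<in>{a..\<tau>}. W (x \<tau>) \<le> exp (- c * (\<tau> - s)) * \<gamma> U)"
    proof (rule flow_bound)
      show "a \<le> \<tau>" "continuous_on {a..\<tau>} x"
        using \<tau> by (auto simp: S_def intro: continuous_on_subset[OF cont])
      fix s assume s: "a \<le> s" "s < \<tau>"
      have "s < b" using s \<tau> by (auto simp: S_def)
      have "(x has_vector_derivative f (pr (x s)) (u s)) (at_right s)"
        using s \<open>s < b\<close> by (intro flow_on_right_derivative[OF x(2)] cf rc) auto
      then show "(x has_vector_derivative f (x s) (u s)) (at_right s)"
        using before[OF s] by (simp add: pr_id)
      show "\<gamma> (norm (u s)) \<le> \<gamma> U"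
        using s \<open>s < b\<close> a by (intro Kinf_mono[OF gain] U) auto
    qed
    then have "W (x \<tau>) \<le> M"
    proof
      assume "W (x \<tau>) \<le> exp (- c * (\<tau> - a)) * W (x a)"
      also have "\<dots> \<le> M" using \<tau> x(1) by (intro M) (auto simp: S_def)
      finally show ?thesis .
    next
      assume "\<exists>s\<in>{a..\<tau>}. W (x \<tau>) \<le> exp (- c * (\<tau> - s)) * \<gamma> U"
      then obtain s where "s \<in> {a..\<tau>}" "W (x \<tau>) \<le> exp (- c * (\<tau> - s)) * \<gamma> U" by blast
      then show ?thesis using M[of "\<tau> - s" "\<gamma> U"] \<tau> by (auto simp: S_def)
    qed
    then show False using r[of "x \<tau>"] \<tau> by (auto simp: S_def)
  qed
  have "flow_on f u x a b"
  proof (rule flow_on_cong[OF x(2)])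
    show "f (pr (x t)) (u t) = f (x t) (u t)" if "t \<in> {a..b}" for t
      using inside[OF that] by (simp add: pr_id)
  qed auto
  then show ?thesis using x(1) that by blast
qed

text \<open>Flows on the intervals \<open>{a..b}\<close> agree where they overlap, by uniqueness.
  The diagonal \<open>S t t\<close> therefore coincides with each of them on its interval.\<close>

lemma flow_exists:
  assumes u: "admissible_input t0 u" and a: "t0 \<le> a"
  obtains x where "x a = x0" "\<And>b. flow_on f u x a b"
proof -
  have "\<exists>x. x a = x0 \<and> flow_on f u x a b" if "a \<le> b" for b
    using flow_exists_interval[OF u a that] by metis
  then obtain S where S: "\<And>b. a \<le> b \<Longrightarrow> S b a = x0" "\<And>b. a \<le> b \<Longrightarrow> flow_on f u (S b) a b"
    by metis
  define x where "x t = S t t" for t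
  have eq: "S b t = x t" if t: "t \<in> {a..b}" for b t
    unfolding x_def
  proof (rule flow_unique[where u = u and x = "S b" and y = "S t" and a = a])
    show "flow_on f u (S b) a t" using t by (intro flow_on_subinterval[OF S(2)[of b]]) auto
    show "flow_on f u (S t) a t" using t S(2)[of t] by auto
    have "bounded (u ` {t0..t})" using u by (simp add: admissible_input_def)
    then show "bounded (u ` {a..t})" using a by (elim bounded_subset) auto
  qed (use u a t S in \<open>auto simp: admissible_input_def\<close>)
  have "flow_on f u x a b" for b
  proof (cases "a \<le> b")
    case True
    then show ?thesis by (intro flow_on_cong[OF S(2)[of b]]) (auto simp: eq)
  qed (simp add: flow_on_def)
  then show ?thesis using that[of x] S(1)[of a] by (simp add: x_def)
qed

text \<open>Flow segments are numbered by the count \<open>N t\<close> of impulses up to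
  \<open>t\<close>, which handles finite and infinite impulse sets alike and makes the solution a
  primitive recursion over the segments.\<close>

lemma solution_exists:
  assumes u: "admissible_input t0 u" and T: "impulse_times t0 T"
  obtains x where "is_solution f g t0 T u x" "x t0 = x0"
proof -
  have "\<exists>x. x a = p \<and> (\<forall>b. flow_on f u x a b)" if "t0 \<le> a" for a p
    using flow_exists[OF u that] by metis
  then obtain fl where fl: "\<And>a p. t0 \<le> a \<Longrightarrow> fl a p a = p" "\<And>a p b. t0 \<le> a \<Longrightarrow> flow_on f u (fl a p) a b"
    by metis
  have "\<exists>l. (u \<longlongrightarrow> l) (at_left \<tau>)" if "\<tau> \<in> T" for \<tau>
    using u T that by (auto simp: admissible_input_def impulse_times_def)
  then obtain ul where ul: "\<And>\<tau>. \<tau> \<in> T \<Longrightarrow> (u \<longlongrightarrow> ul \<tau>) (at_left \<tau>)" by metis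
  define N where "N t = card (T \<inter> {..t})" for t
  have fin: "finite (T \<inter> {..t})" for t using T by (simp add: impulse_times_def)
  have N_less: "N s < N t" if "s < t" "t \<in> T" for s t
  proof -
    have "t \<in> T \<inter> {..t} - T \<inter> {..s}" "T \<inter> {..s} \<subseteq> T \<inter> {..t}" using that by auto
    then have "T \<inter> {..s} \<subset> T \<inter> {..t}" by blast
    then show ?thesis unfolding N_def by (intro psubset_card_mono fin)
  qed
  then have inj: "s = t" if "s \<in> T" "t \<in> T" "N s = N t" for s t
    using that by (metis less_irrefl linorder_neqE_linordered_idom)
  \<comment> \<open>The start of segment \<open>k\<close>: \<open>t0\<close> or the unique impulse
    with number \<open>k\<close>. If there are fewer than \<open>k\<close> impulses the value is
    arbitrary, and the solution never visits that segment.\<close>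
  define \<theta> where "\<theta> k = (if k = 0 then t0 else SOME \<tau>. \<tau> \<in> T \<and> N \<tau> = k)" for k
  have \<theta>_N: "\<theta> (N \<tau>) = \<tau>" if "\<tau> \<in> T" for \<tau>
  proof -
    have "N \<tau> > 0" unfolding N_def using that fin by (auto simp: card_gt_0_iff)
    moreover have "(SOME \<tau>'. \<tau>' \<in> T \<and> N \<tau>' = N \<tau>) = \<tau>"
      by (rule some_equality) (use that inj in auto)
    ultimately show ?thesis by (simp add: \<theta>_def)
  qed
  have \<theta>_le: "t0 \<le> \<theta> (N t) \<and> \<theta> (N t) \<le> t" if "t0 \<le> t" for t
  proof (cases "N t = 0")
    case False
    then have ne: "T \<inter> {..t} \<noteq> {}" by (auto simp: N_def)
    define \<tau> where "\<tau> = Max (T \<inter> {..t})"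
    have \<tau>: "\<tau> \<in> T" "\<tau> \<le> t" using Max_in[OF fin ne] by (auto simp: \<tau>_def)
    have "T \<inter> {..t} = T \<inter> {..\<tau>}"
      using Max_ge[OF fin[of t]] \<tau> by (auto simp: \<tau>_def[symmetric])
    then have "N t = N \<tau>" by (simp add: N_def)
    then show ?thesis using \<tau> \<theta>_N T by (auto simp: impulse_times_def)
  qed (use that in \<open>simp add: \<theta>_def\<close>)
  \<comment> \<open>Each segment is a flow for all later times, so its value at the next impulse is
    the left limit of the solution there. Since \<open>N\<close> counts an impulse at its own time,
    the solution switches to the new segment exactly at that impulse.\<close>
  define curve where "curve = rec_nat (fl t0 x0)
     (\<lambda>k y. fl (\<theta> (Suc k)) (g (y (\<theta> (Suc k))) (ul (\<theta> (Suc k)))))"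
  have curve_0: "curve 0 = fl t0 x0"
    and curve_Suc: "\<And>k. curve (Suc k) = fl (\<theta> (Suc k)) (g (curve k (\<theta> (Suc k))) (ul (\<theta> (Suc k))))"
    by (simp_all add: curve_def)
  define x where "x t = curve (N t) t" for t
  have curve_flow: "flow_on f u (curve k) (\<theta> k) b" if "t0 \<le> \<theta> k" for k b
    using that by (cases k) (auto simp: curve_0 curve_Suc \<theta>_def[of 0] intro: fl)
  have "x t0 = x0"
  proof -
    have "T \<inter> {..t0} = {}" using T by (auto simp: impulse_times_def)
    then show ?thesis using fl(1) by (simp add: x_def N_def curve_0)
  qed
  moreover have "is_solution f g t0 T u x"
    unfolding is_solution_def
  proof (intro conjI allI impI ballI)
    fix a t assume a: "t0 \<le> a" "a \<le> t" and no: "T \<inter> {a<..t} = {}"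
    define k where "k = N a"
    have N_eq: "N s = k" if "s \<in> {a..t}" for s
    proof -
      have "T \<inter> {..s} = T \<inter> {..a}" using that no by force
      then show ?thesis by (simp add: N_def k_def)
    qed
    have "flow_on f u (curve k) a t"
      using flow_on_subinterval[OF curve_flow] \<theta>_le a unfolding k_def by blast
    then have "flow_on f u x a t"
      by (rule flow_on_cong) (auto simp: x_def N_eq)
    then show "((\<lambda>\<tau>. f (x \<tau>) (u \<tau>)) has_integral (x t - x a)) {a..t}"
      using a by (simp add: flow_on_def)
  next
    fix \<tau> assume \<tau>: "\<tau> \<in> T"
    obtain a where a: "t0 \<le> a" "a < \<tau>" "T \<inter> {a<..<\<tau>} = {}"
      using impulse_gap_before[OF T \<tau>] .
    define k where "k = N a"
    have N_eq: "N s = k" if "a \<le> s" "s < \<tau>" for s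
    proof -
      have "T \<inter> {..s} = T \<inter> {..a}" using that a by force
      then show ?thesis by (simp add: N_def k_def)
    qed
    have "T \<inter> {..\<tau>} = insert \<tau> (T \<inter> {..a})" using a \<tau> by force
    then have N\<tau>: "N \<tau> = Suc k" using fin a by (simp add: N_def k_def)
    then have \<theta>\<tau>: "\<theta> (Suc k) = \<tau>" using \<theta>_N[OF \<tau>] by simp
    have "flow_on f u (curve k) a \<tau>"
      using flow_on_subinterval[OF curve_flow] \<theta>_le a unfolding k_def by blast
    then have "continuous_on {a..\<tau>} (curve k)" by (rule flow_on_continuous)
    then have "(curve k \<longlongrightarrow> curve k \<tau>) (at_left \<tau>)"
      using a(2) by (rule continuous_on_Icc_at_leftD)
    moreover have "eventually (\<lambda>s. curve k s = x s) (at_left \<tau>)"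
      unfolding eventually_at_left_field using a by (intro exI[of _ a]) (auto simp: x_def N_eq)
    ultimately have "(x \<longlongrightarrow> curve k \<tau>) (at_left \<tau>)" by (simp add: tendsto_cong)
    moreover have "x \<tau> = g (curve k \<tau>) (ul \<tau>)"
      using a by (simp add: x_def N\<tau> curve_Suc \<theta>\<tau> fl)
    ultimately show "\<exists>xl ul. (x \<longlongrightarrow> xl) (at_left \<tau>) \<and> (u \<longlongrightarrow> ul) (at_left \<tau>) \<and> x \<tau> = g xl ul"
      using ul[OF \<tau>] by blast
  qed
  ultimately show ?thesis using that by blast
qed

end

section \<open>Comparison functions and uniform ISS\<close>

text \<open>Averaging \<open>h\<close> over \<open>[r, 2 r]\<close> makes it continuous, and keeps it monotone and above \<open>h r\<close>.\<close>

lemma Kinf_majorant: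
  fixes h :: "real \<Rightarrow> real"
  assumes mono: "\<And>r s. 0 \<le> r \<Longrightarrow> r \<le> s \<Longrightarrow> h r \<le> h s" and h0: "h 0 = 0"
    and lim: "(h \<longlongrightarrow> 0) (at_right 0)"
  obtains \<sigma> where "Kinf \<sigma>" "\<And>r. 0 \<le> r \<Longrightarrow> h r \<le> \<sigma> r"
proof -
  define A where "A r = integral {1..2} (\<lambda>\<tau>. h (r * \<tau>))" for r
  have int: "(\<lambda>\<tau>. h (r * \<tau>)) integrable_on {1..2}" if "0 \<le> r" for r
    using that by (intro integrable_on_mono_on mono_onI mono mult_left_mono) auto
  have const: "integral {1..2} (\<lambda>_::real. k) = k" "(\<lambda>_::real. k) integrable_on {1..2}" for k :: real
    by (auto intro: integrable_const_ivl)
  have A_lower: "h r \<le> A r" if "0 \<le> r" for r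
  proof -
    have "integral {1..2} (\<lambda>_::real. h r) \<le> A r"
      unfolding A_def
    proof (intro integral_le const int that)
      show "h r \<le> h (r * \<tau>)" if "\<tau> \<in> {1..2}" for \<tau>
        using that \<open>0 \<le> r\<close> mult_left_mono[of 1 \<tau> r] by (intro mono) auto
    qed
    then show ?thesis by (simp only: const)
  qed
  have A_upper: "A r \<le> h (2 * r)" if "0 \<le> r" for r
  proof -
    have "A r \<le> integral {1..2} (\<lambda>_::real. h (2 * r))"
      unfolding A_def
    proof (intro integral_le const int that)
      show "h (r * \<tau>) \<le> h (2 * r)" if "\<tau> \<in> {1..2}" for \<tau>
        using that \<open>0 \<le> r\<close> mult_left_mono[of \<tau> 2 r] by (intro mono) auto
    qed
    then show ?thesis by (simp only: const)
  qed
  have A_mono: "A r \<le> A s" if "0 \<le> r" "r \<le> s" for r s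
    unfolding A_def
  proof (rule integral_le)
    show "(\<lambda>\<tau>. h (r * \<tau>)) integrable_on {1..2}" "(\<lambda>\<tau>. h (s * \<tau>)) integrable_on {1..2}"
      using that by (auto intro: int)
    show "h (r * \<tau>) \<le> h (s * \<tau>)" if "\<tau> \<in> {1..2}" for \<tau>
      using that \<open>0 \<le> r\<close> mult_right_mono[OF \<open>r \<le> s\<close>, of \<tau>] by (intro mono) auto
  qed
  have A_0: "A 0 = 0" using h0 by (simp add: A_def)
  define H where "H r = integral {0..r} h" for r
  have h_int: "h integrable_on {a..b}" if "0 \<le> a" for a b
    using that by (intro integrable_on_mono_on mono_onI mono) auto
  \<comment> \<open>The average becomes a difference quotient of the primitive of \<open>h\<close>,
    which is continuous even where \<open>h\<close> jumps. Only continuity at the origin remains,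
    and \<open>A_upper\<close> squeezes it.\<close>
  have A_eq: "A r = (H (2 * r) - H r) / r" if r: "0 < r" for r
  proof -
    have "((\<lambda>\<tau>. h (r * \<tau>)) has_integral (1 / \<bar>r\<bar>) *\<^sub>R integral {r..2*r} h) ((\<lambda>\<tau>. \<tau> / r) ` {r..2*r})"
      using has_integral_stretch_real[OF integrable_integral[OF h_int[of r "2 * r"]], of r] r by simp
    moreover have "(\<lambda>\<tau>. \<tau> / r) ` {r..2*r} = {1..2}"
      using r by (auto simp: image_iff field_simps intro!: bexI[of _ "r * _"])
    ultimately have "A r = integral {r..2*r} h / r"
      unfolding A_def using r by (simp add: integral_unique)
    moreover have "H r + integral {r..2*r} h = H (2 * r)"
      unfolding H_def using r by (intro Henstock_Kurzweil_Integration.integral_combine h_int) auto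
    ultimately show ?thesis by (simp add: field_simps)
  qed
  have A_cont: "isCont A r" if r: "0 < r" for r
  proof -
    have H: "continuous_on {0..2 * (r + 1)} H"
      unfolding H_def by (intro indefinite_integral_continuous_1 h_int) simp
    have "continuous_on {0<..<r + 1} (\<lambda>s. (H (2 * s) - H s) / s)"
      by (intro continuous_intros continuous_on_compose2[OF H]) auto
    then have "continuous_on {0<..<r + 1} A"
      by (rule continuous_on_eq) (simp add: A_eq)
    then show ?thesis using r by (simp add: continuous_on_eq_continuous_at)
  qed
  have A_cont0: "(A \<longlongrightarrow> 0) (at_right 0)"
  proof (rule tendsto_sandwich[of "\<lambda>_. 0" _ _ "\<lambda>r. h (2 * r)"])
    show "eventually (\<lambda>r. 0 \<le> A r) (at_right 0)"
      using A_mono[of 0] A_0 by (auto simp: eventually_at_filter)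
    show "eventually (\<lambda>r. A r \<le> h (2 * r)) (at_right 0)"
      using A_upper by (auto simp: eventually_at_filter)
    have "filterlim (\<lambda>r::real. 2 * r) (at_right 0) (at_right 0)"
    proof (rule filterlim_at_withinI)
      have "((\<lambda>r::real. 2 * r) \<longlongrightarrow> 2 * 0) (at_right 0)" by (intro tendsto_intros)
      then show "((\<lambda>r::real. 2 * r) \<longlongrightarrow> 0) (at_right 0)" by simp
    qed (auto simp: eventually_at_filter)
    then show "((\<lambda>r. h (2 * r)) \<longlongrightarrow> 0) (at_right 0)" by (rule filterlim_compose[OF lim])
  qed simp
  \<comment> \<open>The summand \<open>r\<close> supplies strict growth and unboundedness, which the
    average alone need not have.\<close>
  define \<sigma> where "\<sigma> r = r + A r" for r
  have "continuous_on {0..} \<sigma>"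
    unfolding \<sigma>_def continuous_on_eq_continuous_within
  proof
    fix r :: real assume "r \<in> {0..}"
    then consider "r = 0" | "r > 0" by force
    then show "continuous (at r within {0..}) (\<lambda>r. r + A r)"
    proof cases
      case 1
      have "continuous (at_right 0) A" using A_cont0 A_0 by (simp add: continuous_within)
      then show ?thesis unfolding 1 at_within_Ici_at_right by (intro continuous_intros)
    next
      case 2
      then show ?thesis 
        by (intro continuous_add continuous_ident continuous_at_imp_continuous_at_within[OF A_cont])
    qed
  qed
  moreover have "strict_mono_on {0..} \<sigma>"
    by (auto simp: strict_mono_on_def \<sigma>_def intro!: add_less_le_mono A_mono)
  moreover have "filterlim \<sigma> at_top at_top"
  proof (rule filterlim_at_top_mono[OF filterlim_ident])
    show "eventually (\<lambda>r. r \<le> \<sigma> r) at_top"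
      using eventually_ge_at_top[of 0] by eventually_elim (use A_mono[of 0] A_0 in \<open>auto simp: \<sigma>_def\<close>)
  qed
  ultimately have "Kinf \<sigma>" by (simp add: Kinf_def \<sigma>_def A_0)
  then show ?thesis using A_lower by (intro that[of \<sigma>]) (auto simp: \<sigma>_def intro: add_increasing)
qed

lemma Kinf_compose_scaled:
  assumes \<sigma>: "Kinf \<sigma>" and \<gamma>: "Kinf \<gamma>" and k: "k > 0"
  shows "Kinf (\<lambda>r. \<sigma> (k * \<gamma> r))"
  unfolding Kinf_def
proof (intro conjI)
  have nn: "0 \<le> k * \<gamma> r" if "0 \<le> r" for r using Kinf_nonneg[OF \<gamma> that] k by simp
  show "continuous_on {0..} (\<lambda>r. \<sigma> (k * \<gamma> r))"
    using \<sigma> \<gamma> nn by (auto simp: Kinf_def intro!: continuous_on_compose2[of "{0..}" \<sigma>] continuous_intros)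
  show "strict_mono_on {0..} (\<lambda>r. \<sigma> (k * \<gamma> r))"
    using \<sigma> \<gamma> nn k unfolding Kinf_def strict_mono_on_def by simp
  show "\<sigma> (k * \<gamma> 0) = 0" using \<sigma> \<gamma> by (simp add: Kinf_def)
  have "filterlim (\<lambda>r. k * \<gamma> r) at_top at_top"
    using \<gamma> k by (intro filterlim_tendsto_pos_mult_at_top[OF tendsto_const]) (auto simp: Kinf_def)
  then show "filterlim (\<lambda>r. \<sigma> (k * \<gamma> r)) at_top at_top"
    using filterlim_compose[of \<sigma> at_top at_top] \<sigma> by (simp add: Kinf_def)
qed

lemma KL_exp_decay:
  assumes \<sigma>: "Kinf \<sigma>" and \<alpha>: "Kinf \<alpha>" and lam: "lam > 0"
  shows "KL (\<lambda>r t. \<sigma> (exp (\<mu> - lam * t) * \<alpha> r))"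
  unfolding KL_def
proof (intro conjI allI impI)
  fix t :: real
  have "Kinf (\<lambda>r. \<sigma> (exp (\<mu> - lam * t) * \<alpha> r))" by (rule Kinf_compose_scaled[OF \<sigma> \<alpha>]) simp
  then show "continuous_on {0..} (\<lambda>r. \<sigma> (exp (\<mu> - lam * t) * \<alpha> r))"
    "strict_mono_on {0..} (\<lambda>r. \<sigma> (exp (\<mu> - lam * t) * \<alpha> r))" "\<sigma> (exp (\<mu> - lam * t) * \<alpha> 0) = 0"
    by (auto simp: Kinf_def)
next
  fix r :: real assume r: "0 \<le> r"
  have \<alpha>r: "\<alpha> r \<ge> 0" using Kinf_nonneg[OF \<alpha> r] .
  have c\<sigma>: "continuous_on {0..} \<sigma>" using \<sigma> by (simp add: Kinf_def)
  show "continuous_on {0..} (\<lambda>t. \<sigma> (exp (\<mu> - lam * t) * \<alpha> r))"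
    using \<alpha>r by (intro continuous_on_compose2[OF c\<sigma>] continuous_intros) auto
  show "\<sigma> (exp (\<mu> - lam * b) * \<alpha> r) \<le> \<sigma> (exp (\<mu> - lam * a) * \<alpha> r)" if "0 \<le> a" "a \<le> b" for a b
    using \<alpha>r that lam by (intro Kinf_mono[OF \<sigma>] mult_right_mono) auto
  have "filterlim (\<lambda>t. lam * t) at_top at_top"
    using lam by (intro filterlim_tendsto_pos_mult_at_top[OF tendsto_const] filterlim_ident) auto
  then have "filterlim (\<lambda>t. - \<mu> + lam * t) at_top at_top"
    by (rule filterlim_tendsto_add_at_top[OF tendsto_const])
  then have "((\<lambda>t. inverse (exp (- \<mu> + lam * t))) \<longlongrightarrow> 0) at_top"
    by (intro tendsto_inverse_0_at_top filterlim_compose[OF exp_at_top])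
  then have "((\<lambda>t. exp (\<mu> - lam * t)) \<longlongrightarrow> 0) at_top"
    by (simp add: exp_minus[symmetric])
  then have "((\<lambda>t. exp (\<mu> - lam * t) * \<alpha> r) \<longlongrightarrow> 0) at_top"
    by (rule tendsto_mult_left_zero)
  from continuous_on_tendsto_compose[OF c\<sigma> this]
  show "((\<lambda>t. \<sigma> (exp (\<mu> - lam * t) * \<alpha> r)) \<longlongrightarrow> 0) at_top"
    using \<alpha>r \<sigma> by (simp add: Kinf_def)
qed

context impulsive_lyapunov
begin

text \<open>The supremum of \<open>W\<close> over balls is monotone, and continuity of
  \<open>W\<close> at the origin makes it small there; \<open>Kinf_majorant\<close> does the
  rest.\<close>

lemma W_upper_bound:
  obtains \<alpha> where "Kinf \<alpha>" "\<And>x. W x \<le> \<alpha> (norm x)"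
proof -
  define h where "h r = Sup (W ` cball 0 r)" for r
  have bdd: "bdd_above (W ` cball 0 r)" for r
    by (intro bounded_imp_bdd_above compact_imp_bounded compact_continuous_image
        continuous_on_subset[OF W_cont]) auto
  have le: "W x \<le> h r" if "norm x \<le> r" for x r
    unfolding h_def using that by (intro cSup_upper bdd) auto
  have mono: "h r \<le> h s" if "0 \<le> r" "r \<le> s" for r s
    unfolding h_def using that by (intro cSup_subset_mono bdd image_mono subset_cball) auto
  have h0: "h 0 = 0" by (simp add: h_def W_0)
  have "(h \<longlongrightarrow> 0) (at_right 0)"
  proof (rule tendstoI)
    fix e :: real assume e: "e > 0"
    have "isCont W 0" using W_cont by (simp add: continuous_on_eq_continuous_at)
    then obtain \<delta> where \<delta>: "\<delta> > 0" "\<And>x. norm x < \<delta> \<Longrightarrow> dist (W x) (W 0) < e / 2"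
      using e unfolding continuous_at_eps_delta by (metis diff_zero dist_norm half_gt_zero)
    have "h r \<le> e / 2" if r: "0 < r" "r < \<delta>" for r
      unfolding h_def
    proof (rule cSup_least)
      show "W ` cball 0 r \<noteq> {}" using r by auto
      fix w assume "w \<in> W ` cball 0 r"
      then obtain x where "w = W x" "norm x \<le> r" by auto
      then show "w \<le> e / 2" using \<delta>(2)[of x] r by (simp add: W_0 dist_real_def)
    qed
    moreover have "0 \<le> h r" if "0 < r" for r using mono[of 0 r] h0 that by simp
    ultimately have "dist (h r) 0 < e" if "0 < r" "r < \<delta>" for r
      using that e by (smt (verit) dist_real_def field_sum_of_halves)
    then show "eventually (\<lambda>r. dist (h r) 0 < e) (at_right 0)"
      unfolding eventually_at_right_field using \<delta>(1) by blast
  qed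
  then obtain \<alpha> where "Kinf \<alpha>" "\<And>r. 0 \<le> r \<Longrightarrow> h r \<le> \<alpha> r"
    using Kinf_majorant[of h] mono h0 by blast
  then show ?thesis using le that[of \<alpha>] by (meson norm_ge_zero order_refl order_trans)
qed

text \<open>Bounding the norm by a function of \<open>W\<close>, instead of \<open>W\<close> from
  below, avoids inverting a comparison function. The supremum of the norm over a sublevel set is
  finite because \<open>W\<close> is radially unbounded.\<close>

lemma W_lower_bound:
  obtains \<sigma> where "Kinf \<sigma>" "\<And>x. norm x \<le> \<sigma> (W x)"
proof -
  define h where "h v = Sup (norm ` {x. W x \<le> v})" for v
  have out: "\<exists>r. \<forall>x. norm x \<ge> r \<longrightarrow> W x > v" for v
    using W_unbounded unfolding filterlim_at_top_dense eventually_at_infinity by blast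
  have bdd: "bdd_above (norm ` {x. W x \<le> v})" for v
  proof -
    obtain r where "\<And>x. norm x \<ge> r \<Longrightarrow> W x > v" using out by blast
    then show ?thesis by (intro bdd_aboveI[of _ r]) (force simp: not_le[symmetric])
  qed
  have le: "norm x \<le> h v" if "W x \<le> v" for x v
    unfolding h_def using that by (intro cSup_upper bdd) auto
  have ne: "0 \<in> {x. W x \<le> v}" if "0 \<le> v" for v using that by (simp add: W_0)
  have mono: "h r \<le> h s" if "0 \<le> r" "r \<le> s" for r s
    unfolding h_def using that ne[of r] by (intro cSup_subset_mono bdd image_mono) auto
  have "{x. W x \<le> 0} = {0}" using W_pos W_0 by (auto simp: not_le[symmetric])
  then have h0: "h 0 = 0" by (simp add: h_def)
  have "(h \<longlongrightarrow> 0) (at_right 0)"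
  proof (rule tendstoI)
    fix e :: real assume e: "e > 0"
    obtain r where r: "\<And>x. norm x \<ge> r \<Longrightarrow> W x > 1" using out by blast
    \<comment> \<open>Points with \<open>W x < 1\<close> lie in the ball of radius \<open>r\<close>.
      On the part of it with norm at least \<open>e / 2\<close>, compactness gives \<open>W\<close>
      a positive lower bound \<open>m\<close>, so \<open>W x < min m 1\<close> forces a norm of at
      most \<open>e / 2\<close>.\<close>
    define K where "K = cball (0::'x) r - ball 0 (e / 2)"
    have "compact K" unfolding K_def by (intro compact_diff) auto
    have "\<exists>m>0. \<forall>x\<in>K. W x \<ge> m"
    proof (cases "K = {}")
      case False
      then obtain x where x: "x \<in> K" "\<And>y. y \<in> K \<Longrightarrow> W x \<le> W y"
        using continuous_attains_inf[OF \<open>compact K\<close> False continuous_on_subset[OF W_cont]] by blast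
      then have "x \<noteq> 0" using e by (auto simp: K_def)
      then show ?thesis using x W_pos by blast
    qed (auto intro: exI[of _ 1])
    then obtain m where m: "m > 0" "\<And>x. x \<in> K \<Longrightarrow> W x \<ge> m" by blast
    have small: "norm x \<le> e / 2" if "W x < min m 1" for x
    proof (rule ccontr)
      assume "\<not> norm x \<le> e / 2"
      moreover have "norm x < r" using r[of x] that by (auto simp: not_le[symmetric])
      ultimately have "x \<in> K" by (auto simp: K_def)
      then show False using m(2)[of x] that by auto
    qed
    have "h v \<le> e / 2" if v: "0 < v" "v < min m 1" for v
      unfolding h_def
    proof (rule cSup_least)
      show "norm ` {x. W x \<le> v} \<noteq> {}" using ne[of v] v by auto
      fix w assume "w \<in> norm ` {x. W x \<le> v}"
      then obtain x where "w = norm x" "W x \<le> v" by auto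
      then show "w \<le> e / 2" using small[of x] v by simp
    qed
    moreover have "0 \<le> h v" if "0 < v" for v using mono[of 0 v] h0 that by simp
    ultimately have "dist (h v) 0 < e" if "0 < v" "v < min m 1" for v
      using that e by (smt (verit) dist_real_def field_sum_of_halves)
    then show "eventually (\<lambda>v. dist (h v) 0 < e) (at_right 0)"
      unfolding eventually_at_right_field using m(1) by (intro exI[of _ "min m 1"]) auto
  qed
  then obtain \<sigma> where \<sigma>: "Kinf \<sigma>" "\<And>r. 0 \<le> r \<Longrightarrow> h r \<le> \<sigma> r"
    using Kinf_majorant[of h] mono h0 by blast
  show ?thesis
  proof (rule that[OF \<sigma>(1)])
    show "norm x \<le> \<sigma> (W x)" for x using le[OF order_refl, of x] \<sigma>(2)[OF W_nonneg] by (rule order_trans)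
  qed
qed

text \<open>\<open>solution_bound\<close> is carried from \<open>W\<close> to norms by
  \<open>\<alpha>\<close> at the initial time and by \<open>\<sigma>\<close> at the final time. Both
  depend on \<open>W\<close> alone, hence the bounds are uniform over the impulse sequences.\<close>

theorem uniform_ISS:
  assumes lam: "lam > 0"
  shows "unif_ISS f g t0 (seq_class t0 c d \<mu> lam)"
proof -
  obtain \<alpha> where \<alpha>: "Kinf \<alpha>" "\<And>x. W x \<le> \<alpha> (norm x)" using W_upper_bound by blast
  obtain \<sigma> where \<sigma>: "Kinf \<sigma>" "\<And>x. norm x \<le> \<sigma> (W x)" using W_lower_bound by blast
  have est: "norm (x t) \<le> max (\<sigma> (exp (\<mu> - lam * (t - t0)) * \<alpha> (norm (x t0))))
        (\<sigma> (exp \<mu> * \<gamma> (Sup ((\<lambda>\<tau>. norm (u \<tau>)) ` {t0..t}))))"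
    if T: "T \<in> seq_class t0 c d \<mu> lam" and u: "admissible_input t0 u"
      and x: "is_solution f g t0 T u x" and t: "t0 \<le> t" for T u x t
  proof -
    define U where "U = Sup ((\<lambda>\<tau>. norm (u \<tau>)) ` {t0..t})"
    obtain U' where "\<And>s. s \<in> {t0..t} \<Longrightarrow> norm (u s) \<le> U'"
      using admissible_input_bounded[OF u] by blast
    then have "bdd_above ((\<lambda>\<tau>. norm (u \<tau>)) ` {t0..t})" by (intro bdd_aboveI2)
    then have U: "norm (u s) \<le> U" if "s \<in> {t0..t}" for s
      unfolding U_def using that by (intro cSup_upper) auto
    have "W (x t) \<le> max (exp (\<mu> - lam * (t - t0)) * W (x t0)) (exp \<mu> * \<gamma> U)"
      by (rule solution_bound[OF x T u lam t U])
    also have "\<dots> \<le> max (exp (\<mu> - lam * (t - t0)) * \<alpha> (norm (x t0))) (exp \<mu> * \<gamma> U)"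
      using \<alpha>(2)[of "x t0"] by (intro max.mono mult_left_mono) auto
    finally have "\<sigma> (W (x t)) \<le> \<sigma> (max (exp (\<mu> - lam * (t - t0)) * \<alpha> (norm (x t0))) (exp \<mu> * \<gamma> U))"
      by (intro Kinf_mono[OF \<sigma>(1)] W_nonneg)
    then have "\<sigma> (W (x t)) \<le> max (\<sigma> (exp (\<mu> - lam * (t - t0)) * \<alpha> (norm (x t0)))) (\<sigma> (exp \<mu> * \<gamma> U))"
      by (auto simp: max_def split: if_splits)
    then show ?thesis using \<sigma>(2)[of "x t"] by (simp add: U_def)
  qed
  show ?thesis
    unfolding unif_ISS_def
  proof (intro exI[of _ "\<lambda>r t. \<sigma> (exp (\<mu> - lam * t) * \<alpha> r)"] exI[of _ "\<lambda>r. \<sigma> (exp \<mu> * \<gamma> r)"]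
      conjI ballI allI impI)
    show "KL (\<lambda>r t. \<sigma> (exp (\<mu> - lam * t) * \<alpha> r))" by (rule KL_exp_decay[OF \<sigma>(1) \<alpha>(1) lam])
    show "Kinf (\<lambda>r. \<sigma> (exp \<mu> * \<gamma> r))" by (rule Kinf_compose_scaled[OF \<sigma>(1) gain]) simp
    fix T and x0 :: 'x and u :: "real \<Rightarrow> 'u" assume T: "T \<in> seq_class t0 c d \<mu> lam" and u: "admissible_input t0 u"
    have "impulse_times t0 T" using T by (simp add: seq_class_def)
    from solution_exists[OF u this]
    show "\<exists>x. is_solution f g t0 T u x \<and> x t0 = x0" by metis
  qed (use est in auto)
qed

end

section \<open>The max-type Lyapunov function of the interconnection\<close>

lemma continuous_on_Max_image:
  fixes v :: "'i \<Rightarrow> 'a::topological_space \<Rightarrow> real"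
  assumes "finite A" "A \<noteq> {}" "\<And>i. i \<in> A \<Longrightarrow> continuous_on S (v i)"
  shows "continuous_on S (\<lambda>x. Max ((\<lambda>i. v i x) ` A))"
  using assms
proof (induction A rule: finite_ne_induct)
  case (insert i F)
  then have "continuous_on S (\<lambda>x. max (v i x) (Max ((\<lambda>i. v i x) ` F)))"
    by (intro continuous_on_max) simp_all
  then show ?case using insert.hyps by simp
qed simp

text \<open>By continuity, an index that is not maximal at \<open>x\<close> cannot become maximal
  nearby. So whichever index realises the maximum at \<open>y\<close> is one with derivative
  \<open>D\<close> at \<open>x\<close>, and its remainder estimate applies.\<close>

lemma has_derivative_Max_image:
  fixes v :: "'i \<Rightarrow> 'a::real_normed_vector \<Rightarrow> real"
  assumes A: "finite A" "i0 \<in> A"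
    and cont: "\<And>i. i \<in> A \<Longrightarrow> isCont (v i) x"
    and max: "\<And>i. i \<in> A \<Longrightarrow> v i x \<le> v i0 x"
    and der: "\<And>i. i \<in> A \<Longrightarrow> v i x = v i0 x \<Longrightarrow> (v i has_derivative D) (at x)"
  shows "((\<lambda>y. Max ((\<lambda>i. v i y) ` A)) has_derivative D) (at x)"
  unfolding has_derivative_within_alt2
proof (intro conjI allI impI)
  show "bounded_linear D" using der[OF A(2)] by (auto dest: has_derivative_bounded_linear)
  fix e :: real assume e: "e > 0"
  have Mx: "Max ((\<lambda>i. v i x) ` A) = v i0 x"
    using A max by (intro Max_eqI) auto
  have "eventually (\<lambda>y. \<forall>i\<in>A. (v i x = v i0 x \<longrightarrow> norm (v i y - v i x - D (y - x)) \<le> e * norm (y - x)) \<and>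
      (v i x \<noteq> v i0 x \<longrightarrow> v i y < v i0 y)) (at x)"
  proof (rule eventually_ball_finite[OF A(1)], intro ballI)
    fix i assume i: "i \<in> A"
    show "eventually (\<lambda>y. (v i x = v i0 x \<longrightarrow> norm (v i y - v i x - D (y - x)) \<le> e * norm (y - x)) \<and>
      (v i x \<noteq> v i0 x \<longrightarrow> v i y < v i0 y)) (at x)"
    proof (cases "v i x = v i0 x")
      case True
      then have "eventually (\<lambda>y. norm (v i y - v i x - D (y - x)) \<le> e * norm (y - x)) (at x)"
        using der[OF i True] e unfolding has_derivative_within_alt2 by blast
      then show ?thesis by eventually_elim (use True in auto)
    next
      case False
      have "((\<lambda>y. v i0 y - v i y) \<longlongrightarrow> v i0 x - v i x) (at x)"
        using cont[OF i] cont[OF A(2)] unfolding isCont_def by (intro tendsto_diff)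
      then have "eventually (\<lambda>y. 0 < v i0 y - v i y) (at x)"
        using max[OF i] False by (intro order_tendstoD) auto
      then show ?thesis by eventually_elim (use False in auto)
    qed
  qed
  then show "eventually (\<lambda>y. norm (Max ((\<lambda>i. v i y) ` A) - Max ((\<lambda>i. v i x) ` A) - D (y - x))
      \<le> e * norm (y - x)) (at x)"
  proof eventually_elim
    case (elim y)
    have "Max ((\<lambda>i. v i y) ` A) \<in> (\<lambda>i. v i y) ` A" using A by (intro Max_in) auto
    then obtain k where k: "k \<in> A" "Max ((\<lambda>i. v i y) ` A) = v k y" by auto
    have "v i0 y \<le> v k y" unfolding k(2)[symmetric] using A by (intro Max_ge) auto
    then have "v k x = v i0 x" using elim k(1) by (meson not_le)
    then show ?case using elim k by (auto simp: Mx)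
  qed
qed

section \<open>Orthogonal projections onto coordinate blocks\<close>

lemma bproj_inner_Basis:
  assumes "B \<subseteq> Basis" "b \<in> Basis"
  shows "bproj B x \<bullet> b = (if b \<in> B then x \<bullet> b else 0)"
proof -
  have "finite B" using assms(1) finite_Basis finite_subset by blast
  have "bproj B x \<bullet> b = (\<Sum>b'\<in>B. if b' = b then x \<bullet> b else 0)"
    unfolding bproj_def inner_sum_left using assms
    by (intro sum.cong) (auto simp: inner_Basis subset_iff)
  then show ?thesis using \<open>finite B\<close> by simp
qed

lemma norm_bproj_le:
  assumes "B \<subseteq> Basis"
  shows "norm (bproj B x) \<le> norm x"
  by (rule norm_le_componentwise) (simp add: bproj_inner_Basis[OF assms])

lemma bproj_diff: "bproj B (x - y) = bproj B x - bproj B y"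
  by (simp add: bproj_def inner_diff_left scaleR_diff_left sum_subtractf)

lemma bounded_linear_bproj: "bounded_linear (bproj B)"
  unfolding linear_conv_bounded_linear[symmetric]
  by (rule linearI)
    (simp_all add: bproj_def inner_add_left scaleR_add_left sum.distrib scaleR_sum_right)

lemma bproj_in_span: "bproj B x \<in> span B"
  unfolding bproj_def by (intro span_sum span_scale span_base)

lemma sum_bproj:
  fixes B :: "nat \<Rightarrow> 'a::euclidean_space set"
  assumes "basis_partition n B"
  shows "(\<Sum>i<n. bproj (B i) x) = x"
proof -
  have un: "(\<Union>i<n. B i) = Basis" and dj: "\<forall>i<n. \<forall>j<n. i \<noteq> j \<longrightarrow> B i \<inter> B j = {}"
    using assms by (auto simp: basis_partition_def)
  have "finite (B i)" if "i < n" for i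
    using un that by (intro finite_subset[OF _ finite_Basis]) auto
  then have "(\<Sum>i<n. bproj (B i) x) = (\<Sum>b\<in>(\<Union>i<n. B i). (x \<bullet> b) *\<^sub>R b)"
    unfolding bproj_def using dj by (subst sum.UNION_disjoint) auto
  then show ?thesis by (simp add: un euclidean_representation)
qed

locale interconnection =
  fixes n :: nat
    and B :: "nat \<Rightarrow> 'x::euclidean_space set" and C :: "nat \<Rightarrow> 'u::euclidean_space set"
    and f g :: "'x \<Rightarrow> 'u \<Rightarrow> 'x"
    and V :: "nat \<Rightarrow> 'x \<Rightarrow> real" and G :: "nat \<Rightarrow> nat \<Rightarrow> real"
    and gam :: "nat \<Rightarrow> real \<Rightarrow> real" and c d s :: "nat \<Rightarrow> real"
  assumes B_part: "basis_partition n B" and C_part: "basis_partition n C"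
    and f_lip: "loc_lipschitz_on UNIV (\<lambda>p. f (fst p) (snd p))"
    and G_nonneg: "\<And>i j. i < n \<Longrightarrow> j < n \<Longrightarrow> G i j \<ge> 0"
    and lyap: "\<And>i. i < n \<Longrightarrow> sub_exp_iss_lyap n B C f g V G gam c d i"
    and s_pos: "\<And>i. i < n \<Longrightarrow> s i > 0"
    and s_Gam: "\<And>i. i < n \<Longrightarrow> Gam n G s i < s i"
begin

abbreviation "W \<equiv> Vtot n B V s"
definition "v i x = V i (bproj (B i) x) / s i"
text \<open>The gain for the flow estimate and for the max form of the jump estimate;
  \<open>gain\<close> differs from it by the factor \<open>max (exp d) 1\<close>.\<close>

definition "\<gamma> r = Max ((\<lambda>i. gam i r / s i) ` {..<n})"

section \<open>Positivity, regularity and growth of the weighted maximum\<close>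

lemma n_pos: "n > 0"
proof (rule gr0I)
  assume "n = 0"
  then have "(Basis :: 'x set) = {}" using B_part by (simp add: basis_partition_def)
  then show False using nonempty_Basis by metis
qed

lemma B_Basis: "i < n \<Longrightarrow> B i \<subseteq> Basis"
  using B_part by (auto simp: basis_partition_def)

lemma C_Basis: "i < n \<Longrightarrow> C i \<subseteq> Basis"
  using C_part by (auto simp: basis_partition_def)

lemma candidate: "i < n \<Longrightarrow> sub_lyap_candidate (B i) (V i)" and Kinf_gam: "i < n \<Longrightarrow> Kinf (gam i)"
  using lyap[of i] by (auto simp: sub_exp_iss_lyap_def)

lemma V_pos: "i < n \<Longrightarrow> \<xi> \<in> span (B i) \<Longrightarrow> \<xi> \<noteq> 0 \<Longrightarrow> V i \<xi> > 0" and V_0: "i < n \<Longrightarrow> V i 0 = 0"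
  using candidate[of i] by (auto simp: sub_lyap_candidate_def)

lemma V_nonneg: "i < n \<Longrightarrow> V i (bproj (B i) x) \<ge> 0"
  using V_pos[of i, OF _ bproj_in_span] V_0[of i] by (cases "bproj (B i) x = 0") (auto intro: less_imp_le)

lemma v_nonneg: "i < n \<Longrightarrow> v i x \<ge> 0"
  using V_nonneg[of i x] s_pos[of i] by (simp add: v_def)

lemma V_eq: "i < n \<Longrightarrow> V i (bproj (B i) x) = s i * v i x"
  using s_pos[of i] by (simp add: v_def)

lemma v_pos_iff: "i < n \<Longrightarrow> v i x > 0 \<longleftrightarrow> bproj (B i) x \<noteq> 0"
  using V_pos[of i, OF _ bproj_in_span, of x] V_0[of i] s_pos[of i] by (auto simp: v_def)

lemma W_eq: "W x = Max ((\<lambda>i. v i x) ` {..<n})"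
  by (simp add: Vtot_def v_def)

lemma v_le_W: "i < n \<Longrightarrow> v i x \<le> W x"
  unfolding W_eq by (intro Max_ge) auto

lemma W_attained: obtains i where "i < n" "W x = v i x"
proof -
  have "W x \<in> (\<lambda>i. v i x) ` {..<n}" unfolding W_eq using n_pos by (intro Max_in) auto
  then show ?thesis using that by auto
qed

lemma \<gamma>_ge: "i < n \<Longrightarrow> gam i r / s i \<le> \<gamma> r"
  unfolding \<gamma>_def by (intro Max_ge) auto

lemma v_cont: "i < n \<Longrightarrow> continuous_on S (v i)"
proof -
  assume i: "i < n"
  have "continuous_on (span (B i)) (V i)" using candidate[OF i] by (simp add: sub_lyap_candidate_def)
  then have "continuous_on S (\<lambda>x. V i (bproj (B i) x))"
    by (rule continuous_on_compose2)
       (auto intro: bproj_in_span linear_continuous_on bounded_linear_bproj)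
  then show ?thesis unfolding v_def using s_pos[OF i] by (intro continuous_intros) auto
qed

lemma v_isCont: "i < n \<Longrightarrow> isCont (v i) x"
  using v_cont[of i UNIV] by (simp add: continuous_on_eq_continuous_at)

lemma W_continuous: "continuous_on UNIV W"
  unfolding W_eq using n_pos by (intro continuous_on_Max_image v_cont) auto

lemma exists_bproj_nonzero:
  assumes "x \<noteq> 0" obtains i where "i < n" "bproj (B i) x \<noteq> 0"
proof -
  have "(\<Sum>i<n. bproj (B i) x) = 0" if "\<forall>i<n. bproj (B i) x = 0"
    using that by (intro sum.neutral) auto
  then show ?thesis using sum_bproj[OF B_part, of x] assms that by metis
qed

lemma v_locally_lipschitz:
  assumes i: "i < n" and z: "bproj (B i) z \<noteq> 0"
  obtains e L where "e > 0" "L \<ge> 0" "\<And>p q. p \<in> ball z e \<Longrightarrow> q \<in> ball z e \<Longrightarrow> \<bar>v i p - v i q\<bar> \<le> L * dist p q"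
proof -
  let ?P = "bproj (B i)"
  have contr: "dist (?P p) (?P q) \<le> dist p q" for p q
    using norm_bproj_le[OF B_Basis[OF i], of "p - q"] by (simp add: dist_norm bproj_diff)
  have "loc_lipschitz_on (span (B i) - {0}) (V i)" using candidate[OF i] by (simp add: sub_lyap_candidate_def)
  moreover have "?P z \<in> span (B i) - {0}" using z bproj_in_span by auto
  ultimately obtain e L where e: "e > 0" and L: "\<And>p q. p \<in> ball (?P z) e \<inter> (span (B i) - {0}) \<Longrightarrow>
      q \<in> ball (?P z) e \<inter> (span (B i) - {0}) \<Longrightarrow> dist (V i p) (V i q) \<le> L * dist p q"
    unfolding loc_lipschitz_on_def by meson
  \<comment> \<open>Projections do not increase distances, so this radius keeps the projected points
    away from 0, where \<open>V i\<close> need not be Lipschitz.\<close>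
  define e' where "e' = min e (norm (?P z))"
  have in_ball: "?P p \<in> ball (?P z) e \<inter> (span (B i) - {0})" if "p \<in> ball z e'" for p
  proof -
    have lt: "dist (?P z) (?P p) < e'" using contr[of z p] that by simp
    then have "?P p \<noteq> 0" by (auto simp: e'_def)
    then show ?thesis using lt bproj_in_span by (auto simp: e'_def)
  qed
  show ?thesis
  proof (rule that[of e' "max L 0 / s i"])
    show "e' > 0" using e z by (simp add: e'_def)
    show "max L 0 / s i \<ge> 0" using s_pos[OF i] by simp
    fix p q assume "p \<in> ball z e'" "q \<in> ball z e'"
    then have "\<bar>V i (?P p) - V i (?P q)\<bar> \<le> L * dist (?P p) (?P q)"
      using L[OF in_ball in_ball] by (simp add: dist_real_def)
    also have "\<dots> \<le> max L 0 * dist p q" by (intro mult_mono contr) auto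
    finally show "\<bar>v i p - v i q\<bar> \<le> max L 0 / s i * dist p q"
      using s_pos[OF i] by (simp add: v_def diff_divide_distrib[symmetric] divide_right_mono)
  qed
qed

text \<open>At \<open>z \<noteq> 0\<close> some blocks may vanish, and the corresponding
  \<open>v j\<close> need not be Lipschitz there. But these vanish at \<open>z\<close> while some
  \<open>v i0\<close> is positive, so near \<open>z\<close> they never attain the maximum.\<close>

lemma W_locally_lipschitz: "loc_lipschitz_on (UNIV - {0}) W"
  unfolding loc_lipschitz_on_def
proof
  fix z :: 'x assume "z \<in> UNIV - {0}"
  then obtain i0 where i0: "i0 < n" "bproj (B i0) z \<noteq> 0" using exists_bproj_nonzero by blast
  define I where "I = {i. i < n \<and> bproj (B i) z \<noteq> 0}"
  have finI: "finite I" by (simp add: I_def)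
  have "\<exists>e L. e > 0 \<and> L \<ge> 0 \<and> (\<forall>p\<in>ball z e. \<forall>q\<in>ball z e. \<bar>v i p - v i q\<bar> \<le> L * dist p q)" if "i \<in> I" for i
  proof -
    have "i < n" "bproj (B i) z \<noteq> 0" using that by (auto simp: I_def)
    then obtain e L where "e > 0" "L \<ge> 0"
      "\<And>p q. p \<in> ball z e \<Longrightarrow> q \<in> ball z e \<Longrightarrow> \<bar>v i p - v i q\<bar> \<le> L * dist p q"
      by (rule v_locally_lipschitz) blast
    then show ?thesis by blast
  qed
  then obtain e L where eL: "\<And>i. i \<in> I \<Longrightarrow> e i > 0" "\<And>i. i \<in> I \<Longrightarrow> L i \<ge> 0"
    "\<And>i p q. i \<in> I \<Longrightarrow> p \<in> ball z (e i) \<Longrightarrow> q \<in> ball z (e i) \<Longrightarrow> \<bar>v i p - v i q\<bar> \<le> L i * dist p q"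
    by metis
  have "eventually (\<lambda>p. \<forall>i\<in>I. p \<in> ball z (e i)) (nhds z)"
    using eL(1) by (intro eventually_ball_finite finI ballI eventually_nhds_in_open) auto
  moreover have "eventually (\<lambda>p. \<forall>j\<in>{..<n} - I. v j p < v i0 p) (nhds z)"
  proof (intro eventually_ball_finite ballI)
    fix j assume j: "j \<in> {..<n} - I"
    have "((\<lambda>p. v i0 p - v j p) \<longlongrightarrow> v i0 z - v j z) (nhds z)"
      using v_isCont[of i0 z] v_isCont[of j z] i0 j
      by (intro tendsto_diff) (auto simp: isCont_def tendsto_nhds_iff)
    moreover have "v i0 z - v j z > 0"
      using i0 j v_pos_iff[of i0 z] v_pos_iff[of j z] v_nonneg[of j z] by (auto simp: I_def)
    ultimately have "eventually (\<lambda>p. 0 < v i0 p - v j p) (nhds z)" by (rule order_tendstoD)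
    then show "eventually (\<lambda>p. v j p < v i0 p) (nhds z)" by eventually_elim simp
  qed simp
  ultimately have "eventually (\<lambda>p. (\<forall>i\<in>I. p \<in> ball z (e i)) \<and> (\<forall>j\<in>{..<n} - I. v j p < v i0 p)) (nhds z)"
    by (rule eventually_conj)
  then obtain \<delta> where \<delta>: "\<delta> > 0" "\<And>p. p \<in> ball z \<delta> \<Longrightarrow>
      (\<forall>i\<in>I. p \<in> ball z (e i)) \<and> (\<forall>j\<in>{..<n} - I. v j p < v i0 p)"
    unfolding eventually_nhds_metric by (auto simp: dist_commute)
  \<comment> \<open>Compare at an index that is maximal at \<open>p\<close>. The sum of the
    constants simply dominates each of them; exchanging \<open>p\<close> and \<open>q\<close> gives
    the other side.\<close>
  have one_sided: "W p - W q \<le> sum L I * dist p q" if p: "p \<in> ball z \<delta>" and q: "q \<in> ball z \<delta>" for p q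
  proof -
    obtain i where i: "i < n" "W p = v i p" using W_attained .
    have "i \<in> I"
    proof (rule ccontr)
      assume "i \<notin> I"
      then have "v i p < v i0 p" using \<delta>(2)[OF p] i by auto
      then show False using v_le_W[OF i0(1), of p] i by simp
    qed
    then have "\<bar>v i p - v i q\<bar> \<le> L i * dist p q" using \<delta>(2)[OF p] \<delta>(2)[OF q] by (intro eL(3)) auto
    moreover have "L i \<le> sum L I" using \<open>i \<in> I\<close> finI eL(2) by (intro member_le_sum) auto
    then have "L i * dist p q \<le> sum L I * dist p q" by (intro mult_right_mono) auto
    ultimately show ?thesis using v_le_W[OF i(1), of q] i(2) by linarith
  qed
  have "dist (W p) (W q) \<le> sum L I * dist p q" if "p \<in> ball z \<delta>" "q \<in> ball z \<delta>" for p q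
    using one_sided[OF that] one_sided[OF that(2) that(1)] by (simp add: dist_real_def dist_commute abs_le_iff)
  then show "\<exists>e>0. \<exists>L. \<forall>p\<in>ball z e \<inter> (UNIV - {0}). \<forall>q\<in>ball z e \<inter> (UNIV - {0}). dist (W p) (W q) \<le> L * dist p q"
    using \<delta>(1) by blast
qed

lemma W_positive: "x \<noteq> 0 \<Longrightarrow> W x > 0"
proof -
  assume "x \<noteq> 0"
  then obtain i where "i < n" "bproj (B i) x \<noteq> 0" by (rule exists_bproj_nonzero)
  then show ?thesis using v_pos_iff[of i x] v_le_W[of i x] by linarith
qed

lemma W_zero: "W 0 = 0"
proof -
  obtain i where "i < n" "W 0 = v i 0" using W_attained .
  then show ?thesis using V_0[of i] by (simp add: v_def bproj_def)
qed

text \<open>A bound on \<open>W\<close> places every block in a compact sublevel set of its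
  \<open>V i\<close>, so the norm of \<open>x\<close> is at most the sum of the block radii.\<close>

lemma W_radially_unbounded: "filterlim W at_top at_infinity"
  unfolding filterlim_at_top eventually_at_infinity
proof
  fix M :: real
  have "\<exists>r. \<forall>\<xi>\<in>span (B i). V i \<xi> \<in> {0..M * s i} \<longrightarrow> norm \<xi> \<le> r" if "i < n" for i
  proof -
    have "compact {\<xi>\<in>span (B i). V i \<xi> \<in> {0..M * s i}}"
      using candidate[OF that] compact_Icc unfolding sub_lyap_candidate_def by blast
    then have "bounded {\<xi>\<in>span (B i). V i \<xi> \<in> {0..M * s i}}" by (rule compact_imp_bounded)
    then show ?thesis unfolding bounded_iff by auto
  qed
  then obtain r where r: "\<And>i \<xi>. i < n \<Longrightarrow> \<xi> \<in> span (B i) \<Longrightarrow> V i \<xi> \<in> {0..M * s i} \<Longrightarrow> norm \<xi> \<le> r i"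
    by metis
  show "\<exists>b. \<forall>x. b \<le> norm x \<longrightarrow> M \<le> W x"
  proof (intro exI allI impI)
    fix x :: 'x assume x: "sum r {..<n} + 1 \<le> norm x"
    show "M \<le> W x"
    proof (rule ccontr)
      assume "\<not> M \<le> W x"
      have "norm (bproj (B i) x) \<le> r i" if i: "i < n" for i
      proof (rule r[OF i bproj_in_span])
        have "v i x \<le> M" using v_le_W[OF i, of x] \<open>\<not> M \<le> W x\<close> by linarith
        then show "V i (bproj (B i) x) \<in> {0..M * s i}"
          using V_nonneg[OF i] s_pos[OF i] by (simp add: v_def field_simps)
      qed
      then have "(\<Sum>i<n. norm (bproj (B i) x)) \<le> sum r {..<n}" by (intro sum_mono) auto
      moreover have "norm x \<le> (\<Sum>i<n. norm (bproj (B i) x))"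
        using norm_sum[of "\<lambda>i. bproj (B i) x" "{..<n}"] by (simp add: sum_bproj[OF B_part])
      ultimately show False using x by linarith
    qed
  qed
qed

lemma Kinf_\<gamma>: "Kinf \<gamma>"
  unfolding Kinf_def
proof (intro conjI)
  have K: "continuous_on {0..} (gam i)" "strict_mono_on {0..} (gam i)" "gam i 0 = 0"
    "filterlim (gam i) at_top at_top" if "i < n" for i
    using Kinf_gam[OF that] by (auto simp: Kinf_def)
  show "continuous_on {0..} \<gamma>"
    unfolding \<gamma>_def using n_pos s_pos
    by (intro continuous_on_Max_image continuous_intros K) (auto simp: less_imp_neq[symmetric])
  show "strict_mono_on {0..} \<gamma>"
  proof (rule strict_mono_onI)
    fix r r' :: real assume r: "r \<in> {0..}" "r' \<in> {0..}" "r < r'"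
    have "\<gamma> r \<in> (\<lambda>i. gam i r / s i) ` {..<n}" unfolding \<gamma>_def using n_pos by (intro Max_in) auto
    then obtain i where i: "i < n" and "\<gamma> r = gam i r / s i" by auto
    then have "\<gamma> r = gam i r / s i" by simp
    also have "gam i r / s i < gam i r' / s i"
      using K(2)[OF i] s_pos[OF i] r by (intro divide_strict_right_mono) (auto simp: strict_mono_on_def)
    also have "\<dots> \<le> \<gamma> r'" by (rule \<gamma>_ge[OF i])
    finally show "\<gamma> r < \<gamma> r'" .
  qed
  have "(\<lambda>i. gam i 0 / s i) ` {..<n} = {0}" using n_pos K(3) by force
  then show "\<gamma> 0 = 0" by (simp add: \<gamma>_def)
  show "filterlim \<gamma> at_top at_top"
  proof (rule filterlim_at_top_mono)
    have "filterlim (\<lambda>r. (1 / s 0) * gam 0 r) at_top at_top"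
      using s_pos[OF n_pos] by (intro filterlim_tendsto_pos_mult_at_top[OF tendsto_const] K n_pos) auto
    then show "filterlim (\<lambda>r. gam 0 r / s 0) at_top at_top" by simp
  qed (simp add: \<gamma>_ge n_pos)
qed

lemma gam_le_\<gamma>:
  assumes "i < n"
  shows "gam i (norm (bproj (C i) u)) \<le> s i * \<gamma> (norm u)"
proof -
  have "gam i (norm (bproj (C i) u)) \<le> gam i (norm u)"
    using assms by (intro Kinf_mono[OF Kinf_gam] norm_bproj_le C_Basis) auto
  then show ?thesis using \<gamma>_ge[OF assms, of "norm u"] s_pos[OF assms] by (simp add: field_simps)
qed

section \<open>Gain arithmetic and the estimates at jumps and along the flow\<close>

lemma others_le_iff:
  "others n B V G i x \<le> k \<longleftrightarrow> 0 \<le> k \<and> (\<forall>j<n. j \<noteq> i \<longrightarrow> G i j * V j (bproj (B j) x) \<le> k)"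
  unfolding others_def by (subst Max_le_iff) auto

lemma gain_row: "i < n \<Longrightarrow> j < n \<Longrightarrow> G i j * s j \<le> s i"
proof -
  assume ij: "i < n" "j < n"
  then have "G i j * s j \<le> Gam n G s i" unfolding Gam_def by (intro Max_ge) auto
  then show ?thesis using s_Gam[OF ij(1)] by linarith
qed

lemma cmin_le: "i < n \<Longrightarrow> cmin n c \<le> c i"
  unfolding cmin_def by (intro Min_le) auto

lemma finite_dmin_set:
  "finite (d ` {..<n} \<union> {- ln (s j / s i * G i j) | i j. i < n \<and> j < n \<and> j \<noteq> i \<and> G i j > 0})"
proof -
  have sub: "{- ln (s j / s i * G i j) | i j. i < n \<and> j < n \<and> j \<noteq> i \<and> G i j > 0}
      \<subseteq> (\<lambda>(i, j). - ln (s j / s i * G i j)) ` ({..<n} \<times> {..<n})" by auto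
  show ?thesis
    by (intro finite_UnI finite_imageI finite_lessThan finite_subset[OF sub] finite_cartesian_product)
qed

lemma dmin_le: "i < n \<Longrightarrow> dmin n G s d \<le> d i"
  unfolding dmin_def by (intro Min_le finite_dmin_set) auto

text \<open>This is what the logarithmic terms of \<open>dmin\<close> encode. A pair with
  \<open>G i j = 0\<close> contributes no term to the minimum, and its inequality is
  trivial.\<close>

lemma gain_le_exp_dmin:
  assumes "i < n" "j < n" "j \<noteq> i"
  shows "G i j * s j \<le> exp (- dmin n G s d) * s i"
proof (cases "G i j > 0")
  case True
  have "dmin n G s d \<le> - ln (s j / s i * G i j)"
    unfolding dmin_def using assms True by (intro Min_le finite_dmin_set) auto
  then have "ln (s j / s i * G i j) \<le> - dmin n G s d" by simp
  moreover have "s j / s i * G i j > 0" using True s_pos assms by simp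
  ultimately have "s j / s i * G i j \<le> exp (- dmin n G s d)" by (metis exp_ln exp_le_cancel_iff)
  then show ?thesis using s_pos[OF assms(1)] by (simp add: field_simps)
next
  case False
  then have "G i j = 0" using G_nonneg[of i j] assms by linarith
  then show ?thesis using s_pos[OF assms(1)] by simp
qed

text \<open>For an index that is maximal after the jump, each of the three terms in its own jump
  bound is at most \<open>s i * ?K\<close>: by \<open>d \<le> d i\<close>, by the logarithmic terms,
  and by the definition of \<open>\<gamma>\<close>.\<close>

lemma W_jump_bound: "W (g x u) \<le> max (exp (- dmin n G s d) * W x) (\<gamma> (norm u))"
proof -
  let ?d = "dmin n G s d" and ?K = "max (exp (- dmin n G s d) * W x) (\<gamma> (norm u))"
  obtain i where i: "i < n" "W (g x u) = v i (g x u)" using W_attained .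
  have si: "s i > 0" using s_pos i by simp
  have W0: "0 \<le> W x" using v_nonneg[OF i(1)] v_le_W[OF i(1)] order_trans by blast
  have "V i (bproj (B i) (g x u)) \<le>
        max (exp (- d i) * V i (bproj (B i) x)) (max (others n B V G i x) (gam i (norm (bproj (C i) u))))"
    using lyap[OF i(1)] by (simp add: sub_exp_iss_lyap_def)
  moreover have "exp (- d i) * V i (bproj (B i) x) \<le> s i * ?K"
  proof -
    have "exp (- d i) * v i x \<le> exp (- ?d) * W x"
      using dmin_le v_le_W v_nonneg i(1) by (intro mult_mono) auto
    also have "\<dots> \<le> ?K" by simp
    finally show ?thesis using si by (simp add: V_eq[OF i(1)] mult.left_commute)
  qed
  moreover have "others n B V G i x \<le> s i * ?K"
    unfolding others_le_iff
  proof (intro conjI allI impI)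
    show "0 \<le> s i * ?K" using si W0 by (simp add: max.coboundedI1)
    fix j assume j: "j < n" "j \<noteq> i"
    have "G i j * V j (bproj (B j) x) = G i j * s j * v j x" by (simp add: V_eq[OF j(1)])
    also have "\<dots> \<le> exp (- ?d) * s i * W x"
      using si by (intro mult_mono[OF gain_le_exp_dmin[OF i(1) j] v_le_W[OF j(1)]] v_nonneg[OF j(1)]) auto
    also have "\<dots> = s i * (exp (- ?d) * W x)" by simp
    also have "\<dots> \<le> s i * ?K" using si by (intro mult_left_mono) auto
    finally show "G i j * V j (bproj (B j) x) \<le> s i * ?K" .
  qed
  moreover have "gam i (norm (bproj (C i) u)) \<le> s i * ?K"
    using gam_le_\<gamma>[OF i(1), of u] si by (elim order_trans) (intro mult_left_mono, auto)
  ultimately have "V i (bproj (B i) (g x u)) \<le> s i * ?K" by linarith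
  then show ?thesis using si i by (simp add: V_eq[OF i(1)])
qed

text \<open>Differentiability of \<open>V i\<close> relative to the subspace
  \<open>span (B i)\<close> suffices for the chain rule, since the projection takes all its values
  there.\<close>

lemma v_has_derivative:
  assumes "i < n" "(V i has_derivative D) (at (bproj (B i) x) within span (B i))"
  shows "(v i has_derivative (\<lambda>h. D (bproj (B i) h) / s i)) (at x)"
proof -
  have "(bproj (B i) has_derivative bproj (B i)) (at x)"
    by (rule bounded_linear_imp_has_derivative[OF bounded_linear_bproj])
  moreover have "(V i has_derivative D) (at (bproj (B i) x) within range (bproj (B i)))"
    by (rule has_derivative_subset[OF assms(2)]) (auto intro: bproj_in_span)
  ultimately have "((\<lambda>x. V i (bproj (B i) x)) has_derivative (\<lambda>h. D (bproj (B i) h))) (at x)"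
    by (rule has_derivative_in_compose)
  then have "((\<lambda>x. inverse (s i) * V i (bproj (B i) x)) has_derivative
      (\<lambda>h. inverse (s i) * D (bproj (B i) h))) (at x)"
    by (rule has_derivative_mult_right)
  then show ?thesis by (simp add: v_def[abs_def] divide_inverse mult.commute)
qed

lemma W_flow_bound: "\<exists>Z\<in>null_sets lebesgue. \<forall>x. x \<notin> Z \<longrightarrow>
   (\<exists>D. (W has_derivative D) (at x) \<and>
      (\<forall>u. W x \<ge> \<gamma> (norm u) \<longrightarrow> D (f x u) \<le> - cmin n c * W x))"
proof -
  have "\<exists>Z. negligible Z \<and> (\<forall>x. x \<notin> Z \<longrightarrow>
        (\<exists>D. (V i has_derivative D) (at (bproj (B i) x) within span (B i)) \<and>
             (\<forall>u. V i (bproj (B i) x) \<ge> max (others n B V G i x) (gam i (norm (bproj (C i) u)))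
                  \<longrightarrow> D (bproj (B i) (f x u)) \<le> - c i * V i (bproj (B i) x))))" if "i < n" for i
    using lyap[OF that] by (auto simp: sub_exp_iss_lyap_def negligible_iff_null_sets)
  then obtain Z where Z: "\<And>i. i < n \<Longrightarrow> negligible (Z i)"
    and ZD: "\<And>i x. i < n \<Longrightarrow> x \<notin> Z i \<Longrightarrow> \<exists>D. (V i has_derivative D) (at (bproj (B i) x) within span (B i)) \<and>
             (\<forall>u. V i (bproj (B i) x) \<ge> max (others n B V G i x) (gam i (norm (bproj (C i) u)))
                  \<longrightarrow> D (bproj (B i) (f x u)) \<le> - c i * V i (bproj (B i) x))"
    by metis
  \<comment> \<open>Points where two scaled functions agree with different derivatives. Together
    with the exceptional sets of the subsystems, which already lie in the full state space, they
    form the null set to be avoided.\<close>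
  define Y where "Y i j = {x. v i x - v j x = 0 \<and>
      (\<exists>D. ((\<lambda>x. v i x - v j x) has_derivative D) (at x) \<and> D \<noteq> (\<lambda>_. 0))}" for i j
  define N where "N = (\<Union>i<n. Z i) \<union> (\<Union>i<n. \<Union>j<n. Y i j)"
  have "negligible (Y i j)" for i j
    unfolding Y_def by (rule negligible_regular_zeros)
  then have "negligible N"
    unfolding N_def using Z
    by (intro negligible_Un negligible_Union) (auto intro!: negligible_Union)
  moreover have "\<exists>D. (W has_derivative D) (at x) \<and>
      (\<forall>u. W x \<ge> \<gamma> (norm u) \<longrightarrow> D (f x u) \<le> - cmin n c * W x)" if x: "x \<notin> N" for x
  proof -
    have "\<exists>D. (V i has_derivative D) (at (bproj (B i) x) within span (B i)) \<and>
             (\<forall>u. V i (bproj (B i) x) \<ge> max (others n B V G i x) (gam i (norm (bproj (C i) u)))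
                  \<longrightarrow> D (bproj (B i) (f x u)) \<le> - c i * V i (bproj (B i) x))" if "i < n" for i
      using ZD[OF that, of x] x that by (auto simp: N_def)
    then obtain D where D: "\<And>i. i < n \<Longrightarrow> (V i has_derivative D i) (at (bproj (B i) x) within span (B i))"
      and Df: "\<And>i u. i < n \<Longrightarrow> V i (bproj (B i) x) \<ge> max (others n B V G i x) (gam i (norm (bproj (C i) u)))
                  \<Longrightarrow> D i (bproj (B i) (f x u)) \<le> - c i * V i (bproj (B i) x)"
      by metis
    define D' where "D' i h = D i (bproj (B i) h) / s i" for i h
    have D': "(v i has_derivative D' i) (at x)" if "i < n" for i
      unfolding D'_def using v_has_derivative[OF that D[OF that]] .
    obtain i where i: "i < n" "W x = v i x" using W_attained .
    have same: "D' j = D' i" if j: "j < n" "v j x = v i x" for j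
    proof -
      have "((\<lambda>x. v j x - v i x) has_derivative (\<lambda>h. D' j h - D' i h)) (at x)"
        by (intro has_derivative_diff D' j i)
      moreover have "x \<notin> Y j i" using x i j by (auto simp: N_def)
      ultimately have "(\<lambda>h. D' j h - D' i h) = (\<lambda>_. 0)" using j(2) by (auto simp: Y_def)
      then show ?thesis by (metis eq_iff_diff_eq_0 ext)
    qed
    have "(W has_derivative D' i) (at x)"
      unfolding W_eq
    proof (rule has_derivative_Max_image)
      show "i \<in> {..<n}" using i by simp
      fix j assume "j \<in> {..<n}"
      then have j: "j < n" by simp
      show "isCont (v j) x" by (rule v_isCont[OF j])
      show "v j x \<le> v i x" using v_le_W[OF j, of x] i by simp
      show "(v j has_derivative D' i) (at x)" if "v j x = v i x" using D'[OF j] same[OF j that] by simp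
    qed simp
    moreover have "D' i (f x u) \<le> - cmin n c * W x" if u: "W x \<ge> \<gamma> (norm u)" for u
    proof -
      have si: "s i > 0" using s_pos i by simp
      have "others n B V G i x \<le> V i (bproj (B i) x)"
        unfolding others_le_iff
      proof (intro conjI allI impI V_nonneg i)
        fix j assume j: "j < n" "j \<noteq> i"
        have "G i j * V j (bproj (B j) x) = G i j * s j * v j x" by (simp add: V_eq[OF j(1)])
        also have "\<dots> \<le> s i * v i x"
          using si unfolding i(2)[symmetric]
          by (intro mult_mono[OF gain_row[OF i(1) j(1)] v_le_W[OF j(1)]] v_nonneg[OF j(1)]) auto
        finally show "G i j * V j (bproj (B j) x) \<le> V i (bproj (B i) x)" by (simp add: V_eq[OF i(1)])
      qed
      moreover have "gam i (norm (bproj (C i) u)) \<le> V i (bproj (B i) x)"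
      proof -
        have "gam i (norm (bproj (C i) u)) \<le> s i * \<gamma> (norm u)" by (rule gam_le_\<gamma>[OF i(1)])
        also have "\<dots> \<le> s i * v i x" using u i si by (intro mult_left_mono) auto
        finally show ?thesis by (simp add: V_eq[OF i(1)])
      qed
      ultimately have "D i (bproj (B i) (f x u)) \<le> - c i * (s i * v i x)"
        using Df[OF i(1), of u] by (simp add: V_eq[OF i(1)])
      then have "D' i (f x u) \<le> - c i * v i x"
        using si unfolding D'_def by (simp add: pos_divide_le_eq mult.left_commute mult.commute)
      also have "\<dots> \<le> - cmin n c * v i x"
        using cmin_le[OF i(1)] v_nonneg[OF i(1)] by (intro mult_right_mono) auto
      finally show ?thesis using i by simp
    qed
    ultimately show ?thesis by blast
  qed
  ultimately show ?thesis by (intro bexI[of _ N]) (auto simp: negligible_iff_null_sets)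
qed

sublocale total: impulsive_lyapunov f g W \<gamma> "cmin n c" "dmin n G s d"
  by unfold_locales
    (fact f_lip W_continuous W_locally_lipschitz W_zero W_positive W_radially_unbounded Kinf_\<gamma>
      W_flow_bound W_jump_bound)+

lemma gain_eq: "gain n gam s (dmin n G s d) = (\<lambda>r. max (exp (dmin n G s d)) 1 * \<gamma> r)"
  by (simp add: gain_def \<gamma>_def fun_eq_iff)

text \<open>Under \<open>W x \<ge> gain\<close>, the factor \<open>exp d\<close> gives
  \<open>\<gamma> (norm u) \<le> exp (- d) * W x\<close>, which collapses the maximum in the jump
  bound. The alternative 1 in the factor ensures \<open>gain \<ge> \<gamma>\<close>, so the flow
  estimate carries over.\<close>

lemma W_exp_iss_lyap:
  "exp_iss_lyap f g W (cmin n c) (dmin n G s d) (gain n gam s (dmin n G s d))"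
proof -
  let ?d = "dmin n G s d"
  have \<gamma>_nn: "0 \<le> \<gamma> (norm u)" for u :: 'u by (intro Kinf_nonneg[OF Kinf_\<gamma>]) simp
  have gain_ge: "\<gamma> (norm u) \<le> gain n gam s ?d (norm u)" for u :: 'u
    using mult_right_mono[OF _ \<gamma>_nn, of 1 "max (exp ?d) 1" u] by (simp add: gain_eq)
  have "Kinf (\<lambda>r::real. r)"
    by (auto simp: Kinf_def strict_mono_on_def filterlim_ident)
  from Kinf_compose_scaled[OF this Kinf_\<gamma>, of "max (exp ?d) 1"]
  have "Kinf (gain n gam s ?d)" by (simp add: gain_eq less_max_iff_disj)
  moreover have "W (g x u) \<le> exp (- ?d) * W x" if "gain n gam s ?d (norm u) \<le> W x" for x u
  proof -
    have "exp ?d * \<gamma> (norm u) \<le> W x"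
      using that mult_right_mono[OF max.cobounded1[of "exp ?d" 1] \<gamma>_nn[of u]] by (simp add: gain_eq)
    then have "\<gamma> (norm u) \<le> exp (- ?d) * W x" by (simp add: exp_minus field_simps)
    then show ?thesis using W_jump_bound[of x u] by simp
  qed
  moreover obtain Z where "Z \<in> null_sets lebesgue" "\<And>x. x \<notin> Z \<Longrightarrow> \<exists>D. (W has_derivative D) (at x) \<and>
      (\<forall>u. W x \<ge> \<gamma> (norm u) \<longrightarrow> D (f x u) \<le> - cmin n c * W x)"
    using W_flow_bound by blast
  then have "\<exists>Z\<in>null_sets lebesgue. \<forall>x. x \<notin> Z \<longrightarrow> (\<exists>D. (W has_derivative D) (at x) \<and>
      (\<forall>u. W x \<ge> gain n gam s ?d (norm u) \<longrightarrow> D (f x u) \<le> - cmin n c * W x))"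
    using gain_ge by (meson order_trans)
  ultimately show ?thesis
    unfolding exp_iss_lyap_def
    using W_continuous W_locally_lipschitz W_zero W_positive W_radially_unbounded by blast
qed

end

theorem theorem4:
  fixes n :: nat
    and B :: "nat \<Rightarrow> 'x::euclidean_space set" and C :: "nat \<Rightarrow> 'u::euclidean_space set"
    and f g :: "'x \<Rightarrow> 'u \<Rightarrow> 'x"
    and V :: "nat \<Rightarrow> 'x \<Rightarrow> real" and G :: "nat \<Rightarrow> nat \<Rightarrow> real"
    and gam :: "nat \<Rightarrow> real \<Rightarrow> real" and c d s :: "nat \<Rightarrow> real" and t0 :: real
  assumes B_part: "basis_partition n B" and B_ne: "\<forall>i<n. B i \<noteq> {}"
    and C_part: "basis_partition n C"
    and f_struct: "\<forall>i<n. \<forall>x u u'. bproj (C i) u = bproj (C i) u' \<longrightarrow>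
                      bproj (B i) (f x u) = bproj (B i) (f x u')"
    and g_struct: "\<forall>i<n. \<forall>x u u'. bproj (C i) u = bproj (C i) u' \<longrightarrow>
                      bproj (B i) (g x u) = bproj (B i) (g x u')"
    and f_lip: "loc_lipschitz_on UNIV (\<lambda>p. f (fst p) (snd p))"
    and G_nonneg: "\<forall>i<n. \<forall>j<n. G i j \<ge> 0" and G_diag: "\<forall>i<n. G i i = 0"
    and lyap: "\<forall>i<n. sub_exp_iss_lyap n B C f g V G gam c d i"
    and d_nz: "\<forall>i<n. d i \<noteq> 0"
    and small_gain: "\<forall>v. (\<forall>i<n. v i \<ge> 0) \<longrightarrow> (\<exists>i<n. v i \<noteq> 0) \<longrightarrow> (\<exists>i<n. Gam n G v i < v i)"
    and s_pos: "\<forall>i<n. s i > 0" and s_Gam: "\<forall>i<n. Gam n G s i < s i"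
  shows "exp_iss_lyap f g (Vtot n B V s) (cmin n c) (dmin n G s d) (gain n gam s (dmin n G s d)) \<and>
         (\<forall>\<mu> lam. \<mu> > 0 \<longrightarrow> lam > 0 \<longrightarrow>
            unif_ISS f g t0 (seq_class t0 (cmin n c) (dmin n G s d) \<mu> lam))"
proof -
  interpret interconnection n B C f g V G gam c d s
    using B_part C_part f_lip G_nonneg lyap s_pos s_Gam by unfold_locales auto
  show ?thesis using W_exp_iss_lyap total.uniform_ISS by blast
qed

end
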